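(* Let $G_1,G_2$ be finite groups. Then $$\mathbf{A}(\leq_{P/K})=\bigoplus_{U\sqsubseteq G_1,G_2}\mathbf{A}^{G_1}_U(\leq)\otimes_{\mathrm{Out}(U)}\mathbf{A}^{G_2}_U(\leq),$$ where $\mathbf{A}(\leq_{P/K})$ is the class incidence matrix of the $(G_1\times G_2)$-poset of subgroups of $G_1\times G_2$ with the partial order $\leq_{P/K}$, the sum is over the finite groups $U$, up to isomorphism, that are isomorphic to a subquotient of $G_1$ and of $G_2$, and $\mathbf{A}^{G_i}_U(\leq)$ is the class incidence matrix of the $G_i$-poset $\mathcal{M}_{G_i}(U)$, $i=1,2$.
   Context: Homomorphisms act from the right and are composed accordingly. A section of a finite group $G$ is a pair $(P,K)$ of subgroups with $K\trianglelefteq P$. $U\sqsubseteq G$ means $U$ is isomorphic to $P/K$ for some section $(P,K)$ of $G$. Subgroups: by Goursat's Lemma, subgroups $L$ of $G_1\times G_2$ correspond bijectively to isomorphisms $\theta\colon P_1/K_1\to P_2/K_2$ with $(P_i,K_i)$ a section of $G_i$, via $L=\{(a_1,a_2)\in P_1\times P_2:(a_1K_1)^\theta=a_2K_2\}$, the graph of $\theta$. For $L$ and $L'=(\theta'\colon P_1'/K_1'\to P_2'/K_2')$ write $L'\leq_{P/K}L$ if $L'\leq L$ and the canonical homomorphisms $P_i'/K_i'\to P_i/K_i$, $pK_i'\mapsto pK_i$, are isomorphisms for $i=1,2$ (the subscript is just the name of the relation). $G_1\times G_2$ acts on subgroups by conjugation. Morphisms: a $U$-morphism of $G$ is an isomorphism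 $\theta\colon P/K\to U$ with $(P,K)$ a section of $G$; $\mathcal{M}_G(U)$ is the set of these. $G$ acts by $\theta^a=\gamma_a^{-1}\theta$, where $\gamma_a\colon P/K\to P^a/K^a$ is conjugation by $a$; $[\theta]_G$ denotes the $G$-orbit and $\mathcal{M}_G(U)/G$ the set of $G$-orbits. The partial order on $\mathcal{M}_G(U)$: $\theta'\leq\theta$ iff $L'\leq L$, where $L=\{(p,(pK)^\theta):p\in P\}\leq G\times U$ is the graph of $\theta$ and $L'$ that of $\theta'$. The action $\theta\mapsto\theta\alpha$ of $\mathrm{Aut}(U)$ induces an action $[\theta]_G\mapsto[\theta\alpha]_G$ on $\mathcal{M}_G(U)/G$, in which $\mathrm{Inn}(U)$ acts trivially, hence an action of $\mathrm{Out}(U)$. Class incidence matrix: if a finite group $G$ acts on a finite poset $(X,\preceq)$ preserving the order and $T$ is a transversal of the orbits, it is $(\mathbf{a}_{xy})_{x,y\in T}$ with $\mathbf{a}_{xy}=\#\{x'\text{ in the orbit of }x: y\preceq x'\}$ (independent of representatives). Thus $\mathbf{A}^G_U(\leq)$ has rows and columns labelled by $\mathcal{M}_G(U)/G$ and entries $\mathbf{a}(\theta,\theta')=\#\{\eta\in[\theta]_G:\eta\geq\theta'\}$; it satisfies $\mathbf{a}(\theta\alpha,\theta'\alpha)=\mathbf{a}(\theta,\theta')$ for $\alpha\in\mathrm{Aut}(U)$. The product $\otimes_H$: let a finite group $H$ act on finite sets $X_1,X_2$, and let $A_i$ be a square matrix with rows and columns labelled by $X_i$ and invariant under simultaneous action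 of $H$ on rows and columns. With $T$ a transversal of the $H$-orbits on $X_1\times X_2$ (diagonal action), $A_1\otimes_H A_2:=R\cdot(A_1\otimes A_2)\cdot C$, where $A_1\otimes A_2$ is the Kronecker product, $R=(r_{xy})_{x\in T,\,y\in X_1\times X_2}$ has $r_{xy}=1$ if $x,y$ are in the same $H$-orbit and $0$ otherwise, and $C=(c_{xy})_{x\in X_1\times X_2,\,y\in T}$ has $c_{xy}=1$ if $x=y$ and $0$ otherwise. (This is independent of $T$.) Labels: the $\mathrm{Out}(U)$-orbit of $([\theta_1]_{G_1},[\theta_2]_{G_2})$ in $\mathcal{M}_{G_1}(U)/G_1\times\mathcal{M}_{G_2}(U)/G_2$ labels the conjugacy class in $G_1\times G_2$ of the subgroup that is the graph of $\theta_1\theta_2^{-1}$; this is a bijection onto the conjugacy classes of subgroups $L=(\theta\colon P_1/K_1\to P_2/K_2)$ with $P_i/K_i\cong U$. The direct sum denotes the block diagonal matrix. *)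

theory Defs
  imports "HOL-Algebra.Group_Action"
begin

section \<open>Sections and subquotients\<close>

definition is_section :: "('a, 'm) monoid_scheme \<Rightarrow> 'a set \<Rightarrow> 'a set \<Rightarrow> bool" where
  "is_section G P K \<longleftrightarrow> subgroup P G \<and> K \<lhd> G\<lparr>carrier := P\<rparr>"

definition quot :: "('a, 'm) monoid_scheme \<Rightarrow> 'a set \<Rightarrow> 'a set \<Rightarrow> 'a set monoid" where
  "quot G P K = G\<lparr>carrier := P\<rparr> Mod K"

definition subquotient :: "('u, 'k) monoid_scheme \<Rightarrow> ('a, 'm) monoid_scheme \<Rightarrow> bool"
    (infix \<open>\<sqsubseteq>\<close> 50) where
  "U \<sqsubseteq> G \<longleftrightarrow> (\<exists>P K. is_section G P K \<and> U \<cong> quot G P K)"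

text \<open>A set of representatives of the isomorphism classes of groups \<open>U\<close> with \<open>U \<sqsubseteq> G1\<close> and
  \<open>U \<sqsubseteq> G2\<close>. In the last clause it is enough to consider the groups of the form \<open>P / K\<close> for
  sections \<open>(P, K)\<close> of \<open>G1\<close>, as every \<open>U \<sqsubseteq> G1\<close>, over whatever type, is isomorphic to such
  a group.\<close>

definition common_subquotient_reps ::
    "('a, 'm) monoid_scheme \<Rightarrow> ('b, 'n) monoid_scheme \<Rightarrow> 'u monoid set \<Rightarrow> bool" where
  "common_subquotient_reps G1 G2 Us \<longleftrightarrow>
     (\<forall>U\<in>Us. group U \<and> U \<sqsubseteq> G1 \<and> U \<sqsubseteq> G2) \<and>
     (\<forall>U\<in>Us. \<forall>V\<in>Us. U \<cong> V \<longrightarrow> U = V) \<and>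
     (\<forall>P K. is_section G1 P K \<and> quot G1 P K \<sqsubseteq> G2 \<longrightarrow> (\<exists>U\<in>Us. quot G1 P K \<cong> U))"

lemma group_quot: "is_section G P K \<Longrightarrow> group (quot G P K)"
  unfolding is_section_def quot_def by (simp add: normal.factorgroup_is_group)

lemma common_subquotient_reps_exists:
  "\<exists>Us :: 'a set monoid set. common_subquotient_reps (G1 :: ('a, 'm) monoid_scheme) G2 Us"
proof -
  define S where "S = {quot G1 P K | P K. is_section G1 P K \<and> quot G1 P K \<sqsubseteq> G2}"
  define r where "r V = (SOME W. W \<in> S \<and> V \<cong> W)" for V :: "'a set monoid"
  have S_group: "group V" if "V \<in> S" for V
    using that group_quot unfolding S_def by blast
  have r: "r V \<in> S" "V \<cong> r V" if "V \<in> S" for V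
    using someI[of "\<lambda>W. W \<in> S \<and> V \<cong> W" V] that unfolding r_def by simp_all
  have r_eq: "r V = r W" if "V \<in> S" "V \<cong> W" for V W
  proof -
    have "W \<cong> V" using group.iso_sym[OF S_group[OF that(1)] that(2)] .
    then have "V \<cong> X \<longleftrightarrow> W \<cong> X" for X :: "'a set monoid"
      using that(2) by (meson iso_trans)
    then show ?thesis unfolding r_def by simp
  qed
  have uniq: "U = V" if UV: "U \<in> r ` S" "V \<in> r ` S" "U \<cong> V" for U V
  proof -
    obtain A B where AB: "A \<in> S" "B \<in> S" "U = r A" "V = r B" using UV by blast
    have 1: "A \<cong> V" using r(2)[OF AB(1)] UV(3) unfolding AB(3) by (rule iso_trans)
    have "V \<cong> B" using group.iso_sym[OF S_group[OF AB(2)] r(2)[OF AB(2)]] unfolding AB(4) .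
    with 1 have "A \<cong> B" by (rule iso_trans)
    then show ?thesis using r_eq[OF AB(1)] AB(3,4) by simp
  qed
  have sub: "U \<sqsubseteq> G1 \<and> U \<sqsubseteq> G2" if US: "U \<in> S" for U
  proof -
    obtain P K where PK: "U = quot G1 P K" "is_section G1 P K" "U \<sqsubseteq> G2"
      using US unfolding S_def by blast
    have "U \<sqsubseteq> G1" unfolding subquotient_def
      by (rule exI[of _ P], rule exI[of _ K]) (simp add: PK(1,2))
    then show ?thesis using PK(3) by simp
  qed
  have "common_subquotient_reps G1 G2 (r ` S)"
    unfolding common_subquotient_reps_def
  proof (intro conjI ballI allI impI)
    fix U assume "U \<in> r ` S"
    then have "U \<in> S" using r(1) by blast
    then show "group U" "U \<sqsubseteq> G1" "U \<sqsubseteq> G2" using S_group sub by simp_all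
  next
    fix U V assume "U \<in> r ` S" "V \<in> r ` S" "U \<cong> V"
    then show "U = V" by (rule uniq)
  next
    fix P K assume "is_section G1 P K \<and> quot G1 P K \<sqsubseteq> G2"
    then have "quot G1 P K \<in> S" unfolding S_def by blast
    then show "\<exists>U \<in> r ` S. quot G1 P K \<cong> U" using r(2) by blast
  qed
  then show ?thesis by (rule exI)
qed

section \<open>Subgroups of a direct product and the order \<open>\<le>\<^bsub>P/K\<^esub>\<close>\<close>

text \<open>For a normal subgroup, left and right cosets agree; the cosets are written \<open>K #> p\<close>.\<close>

definition iso_graph ::
    "('a, 'm) monoid_scheme \<Rightarrow> ('b, 'n) monoid_scheme \<Rightarrow> 'a set \<Rightarrow> 'a set \<Rightarrow> 'b set \<Rightarrow> 'b set \<Rightarrow>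
     ('a set \<Rightarrow> 'b set) \<Rightarrow> ('a \<times> 'b) set" where
  "iso_graph G1 G2 P1 K1 P2 K2 \<theta> =
     {(a1, a2) \<in> P1 \<times> P2. \<theta> (K1 #>\<^bsub>G1\<^esub> a1) = K2 #>\<^bsub>G2\<^esub> a2}"

text \<open>\<open>L = (\<theta> : P1 / K1 \<rightarrow> P2 / K2)\<close> for some isomorphism \<open>\<theta>\<close>. By Goursat's Lemma every subgroup
  \<open>L\<close> of \<open>G1 \<times>\<times> G2\<close> has exactly one such pair of sections.\<close>

definition goursat ::
    "('a, 'm) monoid_scheme \<Rightarrow> ('b, 'n) monoid_scheme \<Rightarrow> ('a \<times> 'b) set \<Rightarrow>
     'a set \<Rightarrow> 'a set \<Rightarrow> 'b set \<Rightarrow> 'b set \<Rightarrow> bool" where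
  "goursat G1 G2 L P1 K1 P2 K2 \<longleftrightarrow>
     is_section G1 P1 K1 \<and> is_section G2 P2 K2 \<and>
     (\<exists>\<theta> \<in> iso (quot G1 P1 K1) (quot G2 P2 K2). L = iso_graph G1 G2 P1 K1 P2 K2 \<theta>)"

text \<open>The map \<open>P' / K' \<rightarrow> P / K\<close>, \<open>p K' \<mapsto> p K\<close> is an isomorphism.\<close>

definition canonical_iso ::
    "('a, 'm) monoid_scheme \<Rightarrow> 'a set \<Rightarrow> 'a set \<Rightarrow> 'a set \<Rightarrow> 'a set \<Rightarrow> bool" where
  "canonical_iso G P' K' P K \<longleftrightarrow>
     (\<exists>f \<in> iso (quot G P' K') (quot G P K). \<forall>p\<in>P'. f (K' #>\<^bsub>G\<^esub> p) = K #>\<^bsub>G\<^esub> p)"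

definition le_PK ::
    "('a, 'm) monoid_scheme \<Rightarrow> ('b, 'n) monoid_scheme \<Rightarrow>
     ('a \<times> 'b) set \<Rightarrow> ('a \<times> 'b) set \<Rightarrow> bool" where
  "le_PK G1 G2 L' L \<longleftrightarrow> L' \<subseteq> L \<and>
     (\<exists>P1' K1' P2' K2' P1 K1 P2 K2.
        goursat G1 G2 L' P1' K1' P2' K2' \<and> goursat G1 G2 L P1 K1 P2 K2 \<and>
        canonical_iso G1 P1' K1' P1 K1 \<and> canonical_iso G2 P2' K2' P2 K2)"

text \<open>\<open>conj_set G a X = X\<^sup>a = a\<^sup>-\<^sup>1 X a\<close>. This is a right action, while
  \<^const>\<open>orbit\<close> and \<^const>\<open>orbits\<close> are used in the library mainly for left actions; the
  set of images of a point is the same notion for both.\<close>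

definition conj_set :: "('a, 'm) monoid_scheme \<Rightarrow> 'a \<Rightarrow> 'a set \<Rightarrow> 'a set" where
  "conj_set G a X = inv\<^bsub>G\<^esub> a <#\<^bsub>G\<^esub> X #>\<^bsub>G\<^esub> a"

section \<open>\<open>U\<close>-morphisms\<close>

text \<open>A \<open>U\<close>-morphism \<open>\<theta> : P / K \<rightarrow> U\<close> is the triple \<open>(P, K, \<theta>)\<close> with \<open>\<theta>\<close> extensional, so that
  equal morphisms are equal triples.\<close>

type_synonym ('a, 'u) morph = "'a set \<times> 'a set \<times> ('a set \<Rightarrow> 'u)"

definition U_morphisms ::
    "('a, 'm) monoid_scheme \<Rightarrow> ('u, 'k) monoid_scheme \<Rightarrow> ('a, 'u) morph set" where
  "U_morphisms G U = {(P, K, \<theta>). is_section G P K \<and>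
     \<theta> \<in> iso (quot G P K) U \<inter> extensional (carrier (quot G P K))}"

text \<open>\<open>\<theta>\<^sup>a = \<gamma>\<^sub>a\<^sup>-\<^sup>1 \<theta>\<close> (composed from left to right), where the inverse of \<open>\<gamma>\<^sub>a\<close> is conjugation
  by \<open>a\<^sup>-\<^sup>1\<close>.\<close>

fun morph_conj ::
    "('a, 'm) monoid_scheme \<Rightarrow> 'a \<Rightarrow> ('a, 'u) morph \<Rightarrow> ('a, 'u) morph" where
  "morph_conj G a (P, K, \<theta>) =
     (conj_set G a P, conj_set G a K,
      \<lambda>X \<in> carrier (quot G (conj_set G a P) (conj_set G a K)). \<theta> (conj_set G (inv\<^bsub>G\<^esub> a) X))"

fun morph_graph :: "('a, 'm) monoid_scheme \<Rightarrow> ('a, 'u) morph \<Rightarrow> ('a \<times> 'u) set" where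
  "morph_graph G (P, K, \<theta>) = {(p, \<theta> (K #>\<^bsub>G\<^esub> p)) | p. p \<in> P}"

definition morph_le ::
    "('a, 'm) monoid_scheme \<Rightarrow> ('a, 'u) morph \<Rightarrow> ('a, 'u) morph \<Rightarrow> bool" where
  "morph_le G \<theta>' \<theta> \<longleftrightarrow> morph_graph G \<theta>' \<subseteq> morph_graph G \<theta>"

definition morph_classes ::
    "('a, 'm) monoid_scheme \<Rightarrow> ('u, 'k) monoid_scheme \<Rightarrow> ('a, 'u) morph set set" where
  "morph_classes G U = orbits G (U_morphisms G U) (morph_conj G)"

text \<open>The graph of \<open>\<theta>1 \<theta>2\<^sup>-\<^sup>1 : P1 / K1 \<rightarrow> P2 / K2\<close>, where \<open>\<theta>1\<close> is applied first.\<close>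

fun quotient_graph ::
    "('a, 'm) monoid_scheme \<Rightarrow> ('b, 'n) monoid_scheme \<Rightarrow>
     ('a, 'u) morph \<Rightarrow> ('b, 'u) morph \<Rightarrow> ('a \<times> 'b) set" where
  "quotient_graph G1 G2 (P1, K1, \<theta>1) (P2, K2, \<theta>2) =
     iso_graph G1 G2 P1 K1 P2 K2 (inv_into (carrier (quot G2 P2 K2)) \<theta>2 \<circ> \<theta>1)"

section \<open>The action of \<open>Out U\<close>\<close>

definition Inn :: "('u, 'k) monoid_scheme \<Rightarrow> ('u \<Rightarrow> 'u) set" where
  "Inn U = {\<lambda>x \<in> carrier U. inv\<^bsub>U\<^esub> u \<otimes>\<^bsub>U\<^esub> x \<otimes>\<^bsub>U\<^esub> u | u. u \<in> carrier U}"

text \<open>The multiplication of \<^const>\<open>AutoGroup\<close> is composition from right to left, so this is the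
  opposite of \<open>Out(U)\<close> with maps written on the right; it has the same elements and the same
  orbits on any set.\<close>

definition Out :: "('u, 'k) monoid_scheme \<Rightarrow> ('u \<Rightarrow> 'u) set monoid" where
  "Out U = AutoGroup U Mod Inn U"

fun morph_aut ::
    "('a, 'm) monoid_scheme \<Rightarrow> ('u \<Rightarrow> 'u) \<Rightarrow> ('a, 'u) morph \<Rightarrow> ('a, 'u) morph" where
  "morph_aut G \<alpha> (P, K, \<theta>) = (P, K, compose (carrier (quot G P K)) \<alpha> \<theta>)"

text \<open>For \<open>c = Inn(U) \<alpha>\<close> the class \<open>[\<theta>]\<close> is sent to \<open>[\<theta> \<alpha>]\<close>, which is the set of all
  \<open>\<theta>' \<alpha>'\<close> with \<open>\<theta>' \<in> [\<theta>]\<close> and \<open>\<alpha>' \<in> c\<close>, because \<open>Inn(U)\<close> fixes every class.\<close>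

definition out_class ::
    "('a, 'm) monoid_scheme \<Rightarrow> ('u \<Rightarrow> 'u) set \<Rightarrow> ('a, 'u) morph set \<Rightarrow> ('a, 'u) morph set" where
  "out_class G c C = {morph_aut G \<alpha> \<theta> | \<alpha> \<theta>. \<alpha> \<in> c \<and> \<theta> \<in> C}"

definition diag_action :: "('h \<Rightarrow> 'x \<Rightarrow> 'x) \<Rightarrow> ('h \<Rightarrow> 'y \<Rightarrow> 'y) \<Rightarrow> 'h \<Rightarrow> 'x \<times> 'y \<Rightarrow> 'x \<times> 'y" where
  "diag_action \<phi> \<psi> h = map_prod (\<phi> h) (\<psi> h)"

section \<open>Labelled matrices\<close>

text \<open>A matrix with labels in \<open>I\<close> is a function of two labels, considered on \<open>I \<times> I\<close> only.\<close>

definition transversal :: "('h, 'k) monoid_scheme \<Rightarrow> 'x set \<Rightarrow> ('h \<Rightarrow> 'x \<Rightarrow> 'x) \<Rightarrow> 'x set \<Rightarrow> bool" where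
  "transversal H X \<phi> T \<longleftrightarrow> T \<subseteq> X \<and> (\<forall>C \<in> orbits H X \<phi>. \<exists>!t. t \<in> T \<inter> C)"

text \<open>Rows and columns of a class incidence matrix are labelled by the orbits. The entry does not
  depend on the representative of the column when the action preserves the order.\<close>

definition class_incidence :: "('x \<Rightarrow> 'x \<Rightarrow> bool) \<Rightarrow> 'x set \<Rightarrow> 'x set \<Rightarrow> int" where
  "class_incidence leq C D = int (card {x \<in> C. leq (SOME y. y \<in> D) x})"

definition mat_prod :: "'j set \<Rightarrow> ('i \<Rightarrow> 'j \<Rightarrow> int) \<Rightarrow> ('j \<Rightarrow> 'l \<Rightarrow> int) \<Rightarrow> 'i \<Rightarrow> 'l \<Rightarrow> int" where
  "mat_prod J A B = (\<lambda>i l. \<Sum>j\<in>J. A i j * B j l)"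

definition kronecker ::
    "('i \<Rightarrow> 'i \<Rightarrow> int) \<Rightarrow> ('j \<Rightarrow> 'j \<Rightarrow> int) \<Rightarrow> 'i \<times> 'j \<Rightarrow> 'i \<times> 'j \<Rightarrow> int" where
  "kronecker A B = (\<lambda>(x1, x2) (y1, y2). A x1 y1 * B x2 y2)"

text \<open>\<open>R \<cdot> (A1 \<otimes> A2) \<cdot> C\<close>; the labels of the result are the elements of a transversal of the
  \<open>H\<close>-orbits on \<open>X1 \<times> X2\<close>.\<close>

definition orbit_tensor ::
    "('h, 'k) monoid_scheme \<Rightarrow> 'x set \<Rightarrow> ('h \<Rightarrow> 'x \<Rightarrow> 'x) \<Rightarrow> 'y set \<Rightarrow> ('h \<Rightarrow> 'y \<Rightarrow> 'y) \<Rightarrow>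
     ('x \<Rightarrow> 'x \<Rightarrow> int) \<Rightarrow> ('y \<Rightarrow> 'y \<Rightarrow> int) \<Rightarrow> 'x \<times> 'y \<Rightarrow> 'x \<times> 'y \<Rightarrow> int" where
  "orbit_tensor H X1 \<phi>1 X2 \<phi>2 A1 A2 =
     (let R = (\<lambda>x y. if y \<in> orbit H (diag_action \<phi>1 \<phi>2) x then 1 else 0);
          C = (\<lambda>x y. if x = y then 1 else 0)
      in mat_prod (X1 \<times> X2) (mat_prod (X1 \<times> X2) R (kronecker A1 A2)) C)"

definition direct_sum :: "('k \<Rightarrow> 'i \<Rightarrow> 'i \<Rightarrow> int) \<Rightarrow> 'k \<times> 'i \<Rightarrow> 'k \<times> 'i \<Rightarrow> int" where
  "direct_sum B = (\<lambda>(k, i) (l, j). if k = l then B k i j else 0)"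

end

theory Submission
  imports Defs
begin

text \<open>The graph \<open>S = {(p, (pK)\<^sup>\<theta>)}\<close> of a \<open>U\<close>-morphism is a subgroup of \<open>G \<times> U\<close> that is a single-valued
  relation onto \<open>U\<close>, and every such subgroup is the graph of exactly one \<open>U\<close>-morphism. In terms of
  graphs everything becomes relation algebra: the subgroup belonging to \<open>(\<theta>1, \<theta>2)\<close> is the relational
  composition \<open>S1 O S2\<inverse>\<close>. Given \<open>L' = S1' O S2'\<inverse>\<close> and \<open>L' \<le>\<^bsub>P/K\<^esub> L\<close>, the \<open>U\<close>-morphisms with
  graphs \<open>L O S2'\<close> and \<open>L\<inverse> O S1'\<close> are the unique ones that lie above \<open>S1'\<close> and \<open>S2'\<close> and yield \<open>L\<close>.
  So the entry counting the conjugates \<open>L\<close> above \<open>L'\<close> counts the pairs of \<open>U\<close>-morphisms above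
  \<open>(\<theta>1', \<theta>2')\<close> whose pair of classes lies in one \<open>Out(U)\<close>-orbit, which is the row sum defining
  \<open>\<otimes>\<^bsub>Out(U)\<^esub>\<close>. Two pairs yield the same subgroup iff they differ by an isomorphism of the
  targets.\<close>

section \<open>Graphs of \<open>U\<close>-morphisms\<close>

text \<open>The formula \<open>L O S2'\<close> is forced: if \<open>L = S1 O S2\<inverse>\<close>
  with \<open>S1' \<subseteq> S1\<close> and \<open>S2' \<subseteq> S2\<close>, then an element
  \<open>a\<close> that \<open>L\<close> relates to some \<open>b\<close> in \<open>P2'\<close> must
  have the value that \<open>b\<close> has under \<open>S2'\<close>. The two halves of the canonical
  isomorphisms make this rule work. Injectivity, \<open>P' \<inter> K \<subseteq> K'\<close>, says
  that the value does not depend on \<open>b\<close>; surjectivity, \<open>P = K P'\<close>, says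
  that every element of \<open>L\<close> can be shifted into reach of the smaller sections, so that
  nothing of \<open>L\<close> is lost. Conversely, containment of graphs of
  \<open>U\<close>-morphisms already makes the canonical maps isomorphisms, because both quotients
  are identified with the same \<open>U\<close>. Lifting \<open>L\<close> to morphisms onto the
  group used for \<open>L'\<close> also shows that the two have isomorphic quotients, which gives
  the zero blocks off the diagonal. The matrices refer to classes, whose representatives are either
  arbitrary or chosen by \<open>SOME\<close>; hence the counts are established for arbitrary
  representatives.\<close>

lemma is_section_subgroups:
  assumes "group G" "is_section G P K"
  shows "subgroup P G" "subgroup K G" "K \<subseteq> P"
proof -
  show P: "subgroup P G" and "K \<subseteq> P"
    using assms subgroup.subset[of K "G\<lparr>carrier := P\<rparr>"]
    by (auto simp: is_section_def normal_def)
  show "subgroup K G"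
    using group.incl_subgroup[OF assms(1) P] assms(2) by (auto simp: is_section_def normal_def)
qed

lemma carrier_quot: "carrier (quot G P K) = (\<lambda>p. K #>\<^bsub>G\<^esub> p) ` P"
  by (simp add: quot_def carrier_FactGroup r_coset_def)

lemma one_quot [simp]: "\<one>\<^bsub>quot G P K\<^esub> = K"
  by (simp add: quot_def)

lemma mult_quot:
  assumes "is_section G P K" "p \<in> P" "q \<in> P"
  shows "(K #>\<^bsub>G\<^esub> p) \<otimes>\<^bsub>quot G P K\<^esub> (K #>\<^bsub>G\<^esub> q) = K #>\<^bsub>G\<^esub> (p \<otimes>\<^bsub>G\<^esub> q)"
  using normal.rcos_sum[of K "G\<lparr>carrier := P\<rparr>" p q] assms
  by (simp add: is_section_def quot_def r_coset_def)

lemma coset_eq_iff: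
  assumes "group G" "subgroup K G" "p \<in> carrier G" "q \<in> carrier G"
  shows "K #>\<^bsub>G\<^esub> p = K #>\<^bsub>G\<^esub> q \<longleftrightarrow> p \<otimes>\<^bsub>G\<^esub> inv\<^bsub>G\<^esub> q \<in> K"
proof -
  interpret group G by fact
  show ?thesis
    by (metis assms(2-4) group_axioms repr_independence repr_independenceD rcos_self
        subgroup.rcos_module)
qed

lemma coset_one:
  assumes "group G" "subgroup K G"
  shows "K #>\<^bsub>G\<^esub> \<one>\<^bsub>G\<^esub> = K"
  using assms group.coset_mult_one subgroup.subset by blast

text \<open>Such an \<open>S\<close> is a homomorphism from the subgroup \<open>Domain S\<close> of
  \<open>G\<close> onto \<open>U\<close>, written as a relation. Its kernel, the fibre over the
  identity, plays the part of \<open>K\<close>.\<close>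

definition partial_epi ::
    "('a, 'm) monoid_scheme \<Rightarrow> ('u, 'k) monoid_scheme \<Rightarrow> ('a \<times> 'u) set \<Rightarrow> bool" where
  "partial_epi G U S \<longleftrightarrow> subgroup S (G \<times>\<times> U) \<and> single_valued S \<and> Range S = carrier U"

lemma DirProd_subgroupD:
  assumes "group G" "group H" "subgroup S (G \<times>\<times> H)"
  shows "(a, b) \<in> S \<Longrightarrow> a \<in> carrier G" "(a, b) \<in> S \<Longrightarrow> b \<in> carrier H"
    "(\<one>\<^bsub>G\<^esub>, \<one>\<^bsub>H\<^esub>) \<in> S"
    "(a, b) \<in> S \<Longrightarrow> (c, d) \<in> S \<Longrightarrow> (a \<otimes>\<^bsub>G\<^esub> c, b \<otimes>\<^bsub>H\<^esub> d) \<in> S"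
    "(a, b) \<in> S \<Longrightarrow> (inv\<^bsub>G\<^esub> a, inv\<^bsub>H\<^esub> b) \<in> S"
proof -
  show A: "a \<in> carrier G" "b \<in> carrier H" if "(a, b) \<in> S" for a b
    using subgroup.subset[OF assms(3)] that by auto
  show "(\<one>\<^bsub>G\<^esub>, \<one>\<^bsub>H\<^esub>) \<in> S"
    using subgroup.one_closed[OF assms(3)] by simp
  show "(a \<otimes>\<^bsub>G\<^esub> c, b \<otimes>\<^bsub>H\<^esub> d) \<in> S" if "(a, b) \<in> S" "(c, d) \<in> S"
    using subgroup.m_closed[OF assms(3) that] by simp
  show "(inv\<^bsub>G\<^esub> a, inv\<^bsub>H\<^esub> b) \<in> S" if "(a, b) \<in> S"
    using subgroup.m_inv_closed[OF assms(3) that] inv_DirProd[OF assms(1,2)] A[OF that] by simp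
qed

lemma DirProd_subgroupI:
  assumes "group G" "group H" "S \<subseteq> carrier G \<times> carrier H"
    and "(\<one>\<^bsub>G\<^esub>, \<one>\<^bsub>H\<^esub>) \<in> S"
    and "\<And>a b c d. (a, b) \<in> S \<Longrightarrow> (c, d) \<in> S \<Longrightarrow> (a \<otimes>\<^bsub>G\<^esub> c, b \<otimes>\<^bsub>H\<^esub> d) \<in> S"
    and "\<And>a b. (a, b) \<in> S \<Longrightarrow> (inv\<^bsub>G\<^esub> a, inv\<^bsub>H\<^esub> b) \<in> S"
  shows "subgroup S (G \<times>\<times> H)"
proof
  show "S \<subseteq> carrier (G \<times>\<times> H)" "\<one>\<^bsub>G \<times>\<times> H\<^esub> \<in> S"
    using assms(3,4) by simp_all
  show "x \<otimes>\<^bsub>G \<times>\<times> H\<^esub> y \<in> S" if "x \<in> S" "y \<in> S" for x y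
    using that assms(5) by (cases x; cases y) simp
  show "inv\<^bsub>G \<times>\<times> H\<^esub> x \<in> S" if "x \<in> S" for x
  proof (cases x)
    case (Pair a b)
    then show ?thesis using that assms(3,6) inv_DirProd[OF assms(1,2)] by fastforce
  qed
qed

text \<open>If \<open>b\<close> and \<open>b'\<close> link two pairs of the composition, then
  \<open>b b'\<close> links the product of the pairs and the inverse of \<open>b\<close> links the
  inverse pair.\<close>

lemma subgroup_relcomp:
  assumes "group G" "group H" "group I" "subgroup S (G \<times>\<times> H)" "subgroup R (H \<times>\<times> I)"
  shows "subgroup (S O R) (G \<times>\<times> I)"
proof (rule DirProd_subgroupI[OF assms(1,3)])
  note S = DirProd_subgroupD[OF assms(1,2,4)] and R = DirProd_subgroupD[OF assms(2,3,5)]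
  show "S O R \<subseteq> carrier G \<times> carrier I" using S(1) R(2) by blast
  show "(\<one>\<^bsub>G\<^esub>, \<one>\<^bsub>I\<^esub>) \<in> S O R" using S(3) R(3) by blast
  show "(a \<otimes>\<^bsub>G\<^esub> c, b \<otimes>\<^bsub>I\<^esub> d) \<in> S O R" if "(a, b) \<in> S O R" "(c, d) \<in> S O R" for a b c d
    using that relcompI[OF S(4) R(4)] by (elim relcompE) simp
  show "(inv\<^bsub>G\<^esub> a, inv\<^bsub>I\<^esub> b) \<in> S O R" if "(a, b) \<in> S O R" for a b
    using that relcompI[OF S(5) R(5)] by (elim relcompE) simp
qed

lemma subgroup_converse:
  assumes "group G" "group H" "subgroup S (G \<times>\<times> H)"
  shows "subgroup (S\<inverse>) (H \<times>\<times> G)"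
  by (rule DirProd_subgroupI[OF assms(2,1)]) (use DirProd_subgroupD[OF assms] in auto)

lemma subgroup_Domain:
  assumes "group G" "group H" "subgroup S (G \<times>\<times> H)"
  shows "subgroup (Domain S) G"
proof -
  interpret group G by fact
  note S = DirProd_subgroupD[OF assms]
  show ?thesis
  proof (rule subgroupI)
    show "Domain S \<subseteq> carrier G" using S(1) by auto
    show "Domain S \<noteq> {}" using S(3) by auto
    show "inv\<^bsub>G\<^esub> a \<in> Domain S" if "a \<in> Domain S" for a
      using that DomainI[OF S(5)] by (elim DomainE)
    show "a \<otimes>\<^bsub>G\<^esub> b \<in> Domain S" if "a \<in> Domain S" "b \<in> Domain S" for a b
      using that DomainI[OF S(4)] by (elim DomainE)
  qed
qed

text \<open>The later conclusions express the isomorphism on representatives of cosets, so that most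
  arguments can be carried out with elements of \<open>P\<close>.\<close>

lemma U_morphismsD:
  assumes "group G" "(P, K, \<theta>) \<in> U_morphisms G U"
  shows "is_section G P K" "\<theta> \<in> iso (quot G P K) U" "\<theta> \<in> extensional (carrier (quot G P K))"
    "\<And>p. p \<in> P \<Longrightarrow> \<theta> (K #>\<^bsub>G\<^esub> p) \<in> carrier U"
    "\<And>p q. p \<in> P \<Longrightarrow> q \<in> P \<Longrightarrow>
       \<theta> (K #>\<^bsub>G\<^esub> (p \<otimes>\<^bsub>G\<^esub> q)) = \<theta> (K #>\<^bsub>G\<^esub> p) \<otimes>\<^bsub>U\<^esub> \<theta> (K #>\<^bsub>G\<^esub> q)"
    "\<And>u. u \<in> carrier U \<Longrightarrow> \<exists>p\<in>P. \<theta> (K #>\<^bsub>G\<^esub> p) = u"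
    "\<And>p q. p \<in> P \<Longrightarrow> q \<in> P \<Longrightarrow>
       \<theta> (K #>\<^bsub>G\<^esub> p) = \<theta> (K #>\<^bsub>G\<^esub> q) \<longleftrightarrow> K #>\<^bsub>G\<^esub> p = K #>\<^bsub>G\<^esub> q"
proof -
  show sec: "is_section G P K" and iso: "\<theta> \<in> iso (quot G P K) U"
    and "\<theta> \<in> extensional (carrier (quot G P K))"
    using assms(2) by (auto simp: U_morphisms_def)
  then have hom: "\<theta> \<in> hom (quot G P K) U" and onto: "\<theta> ` carrier (quot G P K) = carrier U"
    and inj: "inj_on \<theta> (carrier (quot G P K))"
    by (auto simp: iso_iff)
  show "\<theta> (K #>\<^bsub>G\<^esub> p) \<in> carrier U" if "p \<in> P" for p
    using onto that by (auto simp: carrier_quot)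
  show "\<theta> (K #>\<^bsub>G\<^esub> (p \<otimes>\<^bsub>G\<^esub> q)) = \<theta> (K #>\<^bsub>G\<^esub> p) \<otimes>\<^bsub>U\<^esub> \<theta> (K #>\<^bsub>G\<^esub> q)"
    if "p \<in> P" "q \<in> P" for p q
    using hom_mult[OF hom, of "K #>\<^bsub>G\<^esub> p" "K #>\<^bsub>G\<^esub> q"] that
    by (simp add: mult_quot[OF sec] carrier_quot)
  show "\<exists>p\<in>P. \<theta> (K #>\<^bsub>G\<^esub> p) = u" if "u \<in> carrier U" for u
    using onto that unfolding carrier_quot by (metis imageE)
  show "\<theta> (K #>\<^bsub>G\<^esub> p) = \<theta> (K #>\<^bsub>G\<^esub> q) \<longleftrightarrow> K #>\<^bsub>G\<^esub> p = K #>\<^bsub>G\<^esub> q"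
    if "p \<in> P" "q \<in> P" for p q
    using inj that by (auto simp: carrier_quot inj_on_def)
qed

lemma U_morphisms_one:
  assumes "group G" "group U" "(P, K, \<theta>) \<in> U_morphisms G U"
  shows "\<theta> K = \<one>\<^bsub>U\<^esub>"
  using U_morphismsD[OF assms(1,3)] hom_one[of \<theta> "quot G P K" U] group_quot assms(2)
  by (fastforce simp: iso_iff)

lemma mem_morph_graph:
  "(a, u) \<in> morph_graph G (P, K, \<theta>) \<longleftrightarrow> a \<in> P \<and> u = \<theta> (K #>\<^bsub>G\<^esub> a)"
  by auto

lemma partial_epi_morph_graph:
  assumes "group G" "group U" "x \<in> U_morphisms G U"
  shows "partial_epi G U (morph_graph G x)"
proof -
  obtain P K \<theta> where x: "x = (P, K, \<theta>)" by (cases x)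
  note m = U_morphismsD[OF assms(1) assms(3)[unfolded x]]
  note one = U_morphisms_one[OF assms(1,2) assms(3)[unfolded x]]
  note sg = is_section_subgroups[OF assms(1) m(1)]
  interpret G: group G by fact
  interpret U: group U by fact
  interpret P: subgroup P G by (rule sg)
  have "subgroup (morph_graph G x) (G \<times>\<times> U)"
  proof (rule DirProd_subgroupI[OF assms(1,2)])
    show "morph_graph G x \<subseteq> carrier G \<times> carrier U" using m(4) by (auto simp: x)
    show "(\<one>\<^bsub>G\<^esub>, \<one>\<^bsub>U\<^esub>) \<in> morph_graph G x"
      by (simp add: x coset_one[OF assms(1) sg(2)] one)
    show "(a \<otimes>\<^bsub>G\<^esub> c, b \<otimes>\<^bsub>U\<^esub> d) \<in> morph_graph G x"
      if "(a, b) \<in> morph_graph G x" "(c, d) \<in> morph_graph G x" for a b c d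
      using that m(5) by (auto simp: x)
    show "(inv\<^bsub>G\<^esub> a, inv\<^bsub>U\<^esub> b) \<in> morph_graph G x" if "(a, b) \<in> morph_graph G x" for a b
    proof -
      have a: "a \<in> P" "b = \<theta> (K #>\<^bsub>G\<^esub> a)" using that by (auto simp: x)
      have "\<theta> (K #>\<^bsub>G\<^esub> inv\<^bsub>G\<^esub> a) \<otimes>\<^bsub>U\<^esub> b = \<one>\<^bsub>U\<^esub>"
        using m(5)[of "inv\<^bsub>G\<^esub> a" a] a by (simp add: coset_one[OF assms(1) sg(2)] one)
      then have "\<theta> (K #>\<^bsub>G\<^esub> inv\<^bsub>G\<^esub> a) = inv\<^bsub>U\<^esub> b"
        using a m(4) by (simp add: U.inv_equality)
      then show ?thesis using a by (auto simp: x)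
    qed
  qed
  moreover have "u \<in> Range (morph_graph G x) \<longleftrightarrow> u \<in> carrier U" for u
    using m(4) m(6)[of u] by (auto simp: x)
  ultimately show ?thesis unfolding partial_epi_def single_valued_def by (auto simp: x)
qed

text \<open>A morphism that is known only through its graph thereby has a known section; the kernel
  is the coset of the identity because \<open>\<theta>\<close> is injective.\<close>

lemma morph_graph_kernel:
  assumes "group G" "group U" "(P, K, \<theta>) \<in> U_morphisms G U"
  shows "Domain (morph_graph G (P, K, \<theta>)) = P"
    "{a. (a, \<one>\<^bsub>U\<^esub>) \<in> morph_graph G (P, K, \<theta>)} = K"
proof -
  note m = U_morphismsD[OF assms(1,3)] and one = U_morphisms_one[OF assms]
  note sg = is_section_subgroups[OF assms(1) m(1)]
  note K1 = coset_one[OF assms(1) sg(2)]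
  interpret G: group G by fact
  have "a \<in> K \<longleftrightarrow> \<theta> (K #>\<^bsub>G\<^esub> a) = \<one>\<^bsub>U\<^esub>" if "a \<in> P" for a
    using m(7)[of a "\<one>\<^bsub>G\<^esub>"] that sg coset_eq_iff[OF assms(1) sg(2), of a "\<one>\<^bsub>G\<^esub>"]
    by (simp add: K1 one subgroup.one_closed subgroup.mem_carrier)
  then show "{a. (a, \<one>\<^bsub>U\<^esub>) \<in> morph_graph G (P, K, \<theta>)} = K"
    using sg(3) by auto
qed auto

text \<open>Equations between \<open>U\<close>-morphisms become equations between relations. The
  function components agree on all cosets because the graphs do, and elsewhere because both are
  extensional.\<close>

lemma inj_on_morph_graph:
  assumes "group G" "group U"
  shows "inj_on (morph_graph G) (U_morphisms G U)"
proof (rule inj_onI)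
  fix x y assume xy: "x \<in> U_morphisms G U" "y \<in> U_morphisms G U"
    and eq: "morph_graph G x = morph_graph G y"
  obtain P K \<theta> Q L \<psi> where x: "x = (P, K, \<theta>)" and y: "y = (Q, L, \<psi>)"
    by (cases x; cases y)
  have PK: "P = Q" "K = L"
    using eq xy morph_graph_kernel[OF assms] unfolding x y by metis+
  have "\<theta> X = \<psi> X" if "X \<in> carrier (quot G P K)" for X
  proof -
    obtain p where p: "p \<in> P" "X = K #>\<^bsub>G\<^esub> p" using \<open>X \<in> _\<close> by (auto simp: carrier_quot)
    then have "(p, \<theta> X) \<in> morph_graph G y" by (simp add: eq[symmetric] x)
    then show ?thesis using p by (auto simp: y PK)
  qed
  then have "\<theta> = \<psi>"
    using U_morphismsD(3)[OF assms(1)] xy unfolding x y PK by (metis extensionalityI)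
  then show "x = y" by (simp add: x y PK)
qed

text \<open>This is the first isomorphism theorem: \<open>S\<close> is the graph of a surjective
  homomorphism \<open>h\<close> from \<open>Domain S\<close> to \<open>U\<close>, which factors
  through the quotient by its kernel. It allows a morphism to be constructed by writing down its
  graph.\<close>

lemma ex_U_morphism:
  assumes "group G" "group U" "partial_epi G U S"
  obtains x where "x \<in> U_morphisms G U" "morph_graph G x = S"
proof -
  have sub: "subgroup S (G \<times>\<times> U)" and sv: "single_valued S" and ran: "Range S = carrier U"
    using assms(3) by (auto simp: partial_epi_def)
  note S = DirProd_subgroupD[OF assms(1,2) sub]
  define P where "P = Domain S"
  define h where "h p = (THE u. (p, u) \<in> S)" for p
  have h: "(p, u) \<in> S \<longleftrightarrow> p \<in> P \<and> u = h p" for p u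
  proof -
    have "h p = u" if "(p, u) \<in> S" for u
      unfolding h_def using that sv by (auto simp: single_valued_def)
    then show ?thesis by (auto simp: P_def)
  qed
  have P: "subgroup P G" unfolding P_def by (rule subgroup_Domain[OF assms(1,2) sub])
  let ?P = "G\<lparr>carrier := P\<rparr>"
  have "h \<in> hom ?P U"
  proof (rule homI)
    show "h p \<in> carrier U" if "p \<in> carrier ?P" for p
      using that S(2) h by simp
    show "h (p \<otimes>\<^bsub>?P\<^esub> q) = h p \<otimes>\<^bsub>U\<^esub> h q"
      if "p \<in> carrier ?P" "q \<in> carrier ?P" for p q
      using that S(4)[of p "h p" q "h q"] h by simp
  qed
  then interpret group_hom ?P U h
    by (intro group_hom.intro subgroup.subgroup_is_group[OF P] assms)
      (simp add: group_hom_axioms_def)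
  define K where "K = kernel ?P U h"
  have sec: "is_section G P K"
    using P normal_kernel by (simp add: is_section_def K_def)
  have onto: "h ` carrier ?P = carrier U"
    using ran h by (auto simp: set_eq_iff) blast+
  \<comment> \<open>The isomorphism of \<open>FactGroup_iso_set\<close> sends a coset to the only
    element of its image under \<open>h\<close>; the restriction makes it extensional.\<close>
  define \<theta> where "\<theta> = restrict (\<lambda>X. the_elem (h ` X)) (carrier (quot G P K))"
  have "\<theta> \<in> iso (quot G P K) U"
    using group.iso_eq[OF group_quot[OF sec], of _ U \<theta>] FactGroup_iso_set[OF onto]
    unfolding quot_def \<theta>_def K_def by (simp add: \<theta>_def)
  then have x: "(P, K, \<theta>) \<in> U_morphisms G U"
    using sec by (simp add: U_morphisms_def \<theta>_def)
  have "\<theta> (K #>\<^bsub>G\<^esub> p) = h p" if "p \<in> P" for p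
  proof -
    have "h ` (K #>\<^bsub>G\<^esub> p) = {h p}"
    proof -
      have "h (k \<otimes>\<^bsub>G\<^esub> p) = h p" if "k \<in> K" for k
        using that \<open>p \<in> P\<close> hom_mult[of k p] by (simp add: K_def kernel_def)
      moreover have "\<one>\<^bsub>G\<^esub> \<in> K"
        using is_section_subgroups(2)[OF assms(1) sec] by (simp add: subgroup.one_closed)
      ultimately have "(\<lambda>k. h (k \<otimes>\<^bsub>G\<^esub> p)) ` K = {h p}" by auto
      moreover have "h ` (K #>\<^bsub>G\<^esub> p) = (\<lambda>k. h (k \<otimes>\<^bsub>G\<^esub> p)) ` K"
        unfolding r_coset_def by blast
      ultimately show ?thesis by simp
    qed
    then show ?thesis using that by (simp add: \<theta>_def carrier_quot)
  qed
  then have "morph_graph G (P, K, \<theta>) = S"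
    using h by (auto simp: set_eq_iff)
  with x show ?thesis using that by blast
qed

section \<open>Conjugation\<close>

lemma conj_set_eq: "conj_set G a X = (\<lambda>x. inv\<^bsub>G\<^esub> a \<otimes>\<^bsub>G\<^esub> x \<otimes>\<^bsub>G\<^esub> a) ` X"
  by (auto simp: conj_set_def l_coset_def r_coset_def)

context group
begin

lemma conj_mult:
  assumes "a \<in> carrier G" "x \<in> carrier G" "y \<in> carrier G"
  shows "inv a \<otimes> (x \<otimes> y) \<otimes> a = (inv a \<otimes> x \<otimes> a) \<otimes> (inv a \<otimes> y \<otimes> a)"
  using assms by (simp add: m_assoc inv_solve_left' flip: m_assoc[of a "inv a"])

lemma conj_inv:
  assumes "a \<in> carrier G" "x \<in> carrier G"
  shows "inv (inv a \<otimes> x \<otimes> a) = inv a \<otimes> inv x \<otimes> a"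
  using assms by (simp add: inv_mult_group m_assoc)

lemma conj_conj:
  assumes "a \<in> carrier G" "b \<in> carrier G" "x \<in> carrier G"
  shows "inv b \<otimes> (inv a \<otimes> x \<otimes> a) \<otimes> b = inv (a \<otimes> b) \<otimes> x \<otimes> (a \<otimes> b)"
  using assms by (simp add: inv_mult_group m_assoc)

lemma conj_conj_inv:
  assumes "a \<in> carrier G" "x \<in> carrier G"
  shows "inv (inv a) \<otimes> (inv a \<otimes> x \<otimes> a) \<otimes> inv a = x"
  using assms conj_conj[of a "inv a" x] by simp

lemma conj_eq_iff:
  assumes "a \<in> carrier G" "x \<in> carrier G" "y \<in> carrier G"
  shows "inv a \<otimes> x \<otimes> a = inv a \<otimes> y \<otimes> a \<longleftrightarrow> x = y"
  using conj_conj_inv[OF assms(1)] assms(2,3) by metis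

lemma conj_set_r_coset:
  assumes "a \<in> carrier G" "K \<subseteq> carrier G" "p \<in> carrier G"
  shows "conj_set G a (K #> p) = conj_set G a K #> (inv a \<otimes> p \<otimes> a)"
proof -
  have "inv a \<otimes> (k \<otimes> p) \<otimes> a = (inv a \<otimes> k \<otimes> a) \<otimes> (inv a \<otimes> p \<otimes> a)" if "k \<in> K" for k
    using assms that by (intro conj_mult) auto
  then show ?thesis
    by (force simp: conj_set_eq r_coset_def)
qed

lemma conj_set_conj_set:
  assumes "a \<in> carrier G" "b \<in> carrier G" "X \<subseteq> carrier G"
  shows "conj_set G b (conj_set G a X) = conj_set G (a \<otimes> b) X"
proof -
  have "inv b \<otimes> (inv a \<otimes> x \<otimes> a) \<otimes> b = inv (a \<otimes> b) \<otimes> x \<otimes> (a \<otimes> b)" if "x \<in> X" for x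
    using assms that by (intro conj_conj) auto
  then show ?thesis by (simp add: conj_set_eq image_image)
qed

lemma conj_set_one:
  assumes "X \<subseteq> carrier G"
  shows "conj_set G \<one> X = X"
proof -
  have "inv \<one> \<otimes> x \<otimes> \<one> = x" if "x \<in> X" for x using assms that by auto
  then show ?thesis by (simp add: conj_set_eq)
qed

lemma subgroup_conj_set:
  assumes "a \<in> carrier G" "subgroup X G"
  shows "subgroup (conj_set G a X) G"
proof (rule subgroupI)
  interpret X: subgroup X G by fact
  show "conj_set G a X \<subseteq> carrier G" using assms(1) by (auto simp: conj_set_eq)
  show "conj_set G a X \<noteq> {}" unfolding conj_set_eq using X.one_closed by blast
  show "inv x \<in> conj_set G a X" if "x \<in> conj_set G a X" for x
    using that assms(1) conj_inv[OF assms(1)] by (auto simp: conj_set_eq)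
  show "x \<otimes> y \<in> conj_set G a X" if "x \<in> conj_set G a X" "y \<in> conj_set G a X" for x y
    using that assms(1) by (auto simp: conj_set_eq conj_mult[OF assms(1), symmetric])
qed

end

text \<open>The order in \<open>act_mult\<close> is that of a right action, as conjugation
  \<open>a\<inverse> X a\<close> requires. An orbit is still the set of images of a point.\<close>

locale right_action = group G for G (structure) +
  fixes E :: "'x set" and \<phi> :: "'a \<Rightarrow> 'x \<Rightarrow> 'x"
  assumes closed: "\<And>a x. a \<in> carrier G \<Longrightarrow> x \<in> E \<Longrightarrow> \<phi> a x \<in> E"
    and act_one: "\<And>x. x \<in> E \<Longrightarrow> \<phi> \<one> x = x"
    and act_mult: "\<And>a b x. a \<in> carrier G \<Longrightarrow> b \<in> carrier G \<Longrightarrow> x \<in> E \<Longrightarrow>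
      \<phi> b (\<phi> a x) = \<phi> (a \<otimes> b) x"
begin

lemma orbit_self: "x \<in> E \<Longrightarrow> x \<in> orbit G \<phi> x"
  unfolding orbit_def using act_one[of x] by force

lemma orbit_subset: "x \<in> E \<Longrightarrow> orbit G \<phi> x \<subseteq> E"
  unfolding orbit_def using closed by blast

lemma act_inv: "a \<in> carrier G \<Longrightarrow> x \<in> E \<Longrightarrow> \<phi> (inv a) (\<phi> a x) = x"
  using act_mult[of a "inv a" x] act_one by simp

lemma orbit_eq_iff:
  assumes "x \<in> E" "y \<in> E"
  shows "orbit G \<phi> y = orbit G \<phi> x \<longleftrightarrow> y \<in> orbit G \<phi> x"
proof
  show "y \<in> orbit G \<phi> x" if "orbit G \<phi> y = orbit G \<phi> x"
    using that orbit_self[OF assms(2)] by simp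
next
  have *: "orbit G \<phi> y \<subseteq> orbit G \<phi> x" if "x \<in> E" "a \<in> carrier G" "y = \<phi> a x" for x y a
    using that by (auto simp: orbit_def act_mult)
  assume "y \<in> orbit G \<phi> x"
  then obtain a where a: "a \<in> carrier G" "y = \<phi> a x" by (auto simp: orbit_def)
  then have "x = \<phi> (inv a) y" using act_inv assms by simp
  with *[OF assms(1) a] *[OF assms(2) inv_closed[OF a(1)]]
  show "orbit G \<phi> y = orbit G \<phi> x" by blast
qed

lemma orbit_act: "x \<in> E \<Longrightarrow> a \<in> carrier G \<Longrightarrow> orbit G \<phi> (\<phi> a x) = orbit G \<phi> x"
  by (subst orbit_eq_iff) (auto simp: closed orbit_def)

end

lemma (in group) right_action_conj_set:
  "right_action G {L. subgroup L G} (conj_set G)"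
  by unfold_locales (auto simp: subgroup_conj_set conj_set_one conj_set_conj_set subgroup.subset)

text \<open>Passing from \<open>\<theta>\<close> to
  \<open>\<gamma>\<^sub>a\<inverse> \<theta>\<close> moves the argument and keeps the value, so only
  the first coordinate is conjugated.\<close>

definition graph_conj :: "('a, 'm) monoid_scheme \<Rightarrow> 'a \<Rightarrow> ('a \<times> 'u) set \<Rightarrow> ('a \<times> 'u) set" where
  "graph_conj G a S = (\<lambda>(p, u). (inv\<^bsub>G\<^esub> a \<otimes>\<^bsub>G\<^esub> p \<otimes>\<^bsub>G\<^esub> a, u)) ` S"

lemma mem_graph_conj:
  "(q, u) \<in> graph_conj G a S \<longleftrightarrow> (\<exists>p. (p, u) \<in> S \<and> q = inv\<^bsub>G\<^esub> a \<otimes>\<^bsub>G\<^esub> p \<otimes>\<^bsub>G\<^esub> a)"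
  by (auto simp: graph_conj_def)

lemma partial_epi_graph_conj:
  assumes "group G" "group U" "partial_epi G U S" "a \<in> carrier G"
  shows "partial_epi G U (graph_conj G a S)"
proof -
  have sub: "subgroup S (G \<times>\<times> U)" and sv: "single_valued S" and ran: "Range S = carrier U"
    using assms(3) by (auto simp: partial_epi_def)
  note S = DirProd_subgroupD[OF assms(1,2) sub]
  interpret G: group G by fact
  have "subgroup (graph_conj G a S) (G \<times>\<times> U)"
  proof (rule DirProd_subgroupI[OF assms(1,2)])
    show "graph_conj G a S \<subseteq> carrier G \<times> carrier U"
      using S(1,2) assms(4) by (auto simp: graph_conj_def)
    show "(\<one>\<^bsub>G\<^esub>, \<one>\<^bsub>U\<^esub>) \<in> graph_conj G a S"
      using S(3) assms(4) by (auto simp: mem_graph_conj intro!: exI[of _ "\<one>\<^bsub>G\<^esub>"])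
    show "(x \<otimes>\<^bsub>G\<^esub> z, y \<otimes>\<^bsub>U\<^esub> w) \<in> graph_conj G a S"
      if xy: "(x, y) \<in> graph_conj G a S" "(z, w) \<in> graph_conj G a S" for x y z w
    proof -
      obtain p q where "(p, y) \<in> S" "(q, w) \<in> S"
        "x = inv\<^bsub>G\<^esub> a \<otimes>\<^bsub>G\<^esub> p \<otimes>\<^bsub>G\<^esub> a" "z = inv\<^bsub>G\<^esub> a \<otimes>\<^bsub>G\<^esub> q \<otimes>\<^bsub>G\<^esub> a"
        using xy by (auto simp: mem_graph_conj)
      then show ?thesis
        using S(4)[of p y q w] S(1) G.conj_mult[OF assms(4), of p q] by (auto simp: mem_graph_conj)
    qed
    show "(inv\<^bsub>G\<^esub> x, inv\<^bsub>U\<^esub> y) \<in> graph_conj G a S" if xy: "(x, y) \<in> graph_conj G a S" for x y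
    proof -
      obtain p where "(p, y) \<in> S" "x = inv\<^bsub>G\<^esub> a \<otimes>\<^bsub>G\<^esub> p \<otimes>\<^bsub>G\<^esub> a"
        using xy by (auto simp: mem_graph_conj)
      then show ?thesis
        using S(5)[of p y] S(1) G.conj_inv[OF assms(4), of p] by (auto simp: mem_graph_conj)
    qed
  qed
  moreover have "single_valued (graph_conj G a S)"
  proof (rule single_valuedI)
    fix q u v assume "(q, u) \<in> graph_conj G a S" "(q, v) \<in> graph_conj G a S"
    then obtain p p' where p: "(p, u) \<in> S" "(p', v) \<in> S"
      "inv\<^bsub>G\<^esub> a \<otimes>\<^bsub>G\<^esub> p \<otimes>\<^bsub>G\<^esub> a = inv\<^bsub>G\<^esub> a \<otimes>\<^bsub>G\<^esub> p' \<otimes>\<^bsub>G\<^esub> a"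
      by (auto simp: mem_graph_conj)
    then have "p = p'" using S(1) G.conj_eq_iff[OF assms(4)] by metis
    then show "u = v" using p sv by (auto dest: single_valuedD)
  qed
  moreover have "Range (graph_conj G a S) = carrier U"
    unfolding ran[symmetric] by (auto simp: mem_graph_conj Range_iff)
  ultimately show ?thesis by (simp add: partial_epi_def)
qed

text \<open>The conjugated graph belongs to some \<open>U\<close>-morphism by
  \<open>ex_U_morphism\<close>, and its three components are then identified with those of
  \<open>morph_conj\<close>. That conjugation induces an isomorphism of quotients comes out as a
  by-product.\<close>

lemma morph_conj_graph:
  assumes "group G" "group U" "x \<in> U_morphisms G U" "a \<in> carrier G"
  shows "morph_conj G a x \<in> U_morphisms G U"
    and "morph_graph G (morph_conj G a x) = graph_conj G a (morph_graph G x)"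
proof -
  obtain P K \<theta> where x: "x = (P, K, \<theta>)" by (cases x)
  interpret G: group G by fact
  note m = assms(3)[unfolded x]
  note sg = is_section_subgroups[OF assms(1) U_morphismsD(1)[OF assms(1) m]]
  have sub: "P \<subseteq> carrier G" "K \<subseteq> carrier G"
    using sg subgroup.subset by blast+
  obtain Q L \<psi> where y: "(Q, L, \<psi>) \<in> U_morphisms G U"
    and g: "morph_graph G (Q, L, \<psi>) = graph_conj G a (morph_graph G x)"
    using ex_U_morphism[OF assms(1,2) partial_epi_graph_conj[OF assms(1,2)
      partial_epi_morph_graph[OF assms(1-3)] assms(4)]] by (metis prod.exhaust)
  have Q: "Q = conj_set G a P"
  proof -
    have "q \<in> Domain (morph_graph G (Q, L, \<psi>)) \<longleftrightarrow> q \<in> conj_set G a P" for q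
      unfolding g by (auto simp: mem_graph_conj x conj_set_eq Domain_iff)
    then show ?thesis using morph_graph_kernel(1)[OF assms(1,2) y] by blast
  qed
  have L: "L = conj_set G a K"
  proof -
    have "(q, \<one>\<^bsub>U\<^esub>) \<in> morph_graph G (Q, L, \<psi>) \<longleftrightarrow> q \<in> conj_set G a K" for q
      using morph_graph_kernel(2)[OF assms(1,2) m]
      unfolding g x by (auto simp: mem_graph_conj conj_set_eq simp del: morph_graph.simps)
    then show ?thesis using morph_graph_kernel(2)[OF assms(1,2) y] by blast
  qed
  have "\<psi> X = \<theta> (conj_set G (inv\<^bsub>G\<^esub> a) X)" if X: "X \<in> carrier (quot G Q L)" for X
  proof -
    obtain p where p: "p \<in> P" "X = L #>\<^bsub>G\<^esub> (inv\<^bsub>G\<^esub> a \<otimes>\<^bsub>G\<^esub> p \<otimes>\<^bsub>G\<^esub> a)"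
      using X by (auto simp: carrier_quot Q conj_set_eq)
    \<comment> \<open>The coset \<open>X\<close> is the conjugate of the coset of \<open>p\<close>,
      so conjugating by the inverse of \<open>a\<close> returns the argument at which
      \<open>morph_conj\<close> evaluates \<open>\<theta>\<close>.\<close>
    have "X = conj_set G a (K #>\<^bsub>G\<^esub> p)"
      using G.conj_set_r_coset[OF assms(4) sub(2)] p sub by (auto simp: L)
    then have "conj_set G (inv\<^bsub>G\<^esub> a) X = K #>\<^bsub>G\<^esub> p"
      using G.conj_set_conj_set[of a "inv\<^bsub>G\<^esub> a" "K #>\<^bsub>G\<^esub> p"] assms(4) p(1) sub
      by (simp add: G.r_coset_subset_G G.conj_set_one subsetD)
    moreover have "(inv\<^bsub>G\<^esub> a \<otimes>\<^bsub>G\<^esub> p \<otimes>\<^bsub>G\<^esub> a, \<theta> (K #>\<^bsub>G\<^esub> p)) \<in> morph_graph G (Q, L, \<psi>)"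
      unfolding g using p(1) by (auto simp: mem_graph_conj x)
    ultimately show ?thesis using p by (simp add: mem_morph_graph)
  qed
  then have "morph_conj G a x = (Q, L, \<psi>)"
    using U_morphismsD(3)[OF assms(1) y]
    by (auto simp: x Q L extensional_def restrict_def)
  then show "morph_conj G a x \<in> U_morphisms G U"
    and "morph_graph G (morph_conj G a x) = graph_conj G a (morph_graph G x)"
    using y g by simp_all
qed

text \<open>By \<open>inj_on_morph_graph\<close> the two laws can be checked on graphs, where they
  are the laws for conjugating single elements.\<close>

lemma right_action_morph_conj:
  assumes "group G" "group U"
  shows "right_action G (U_morphisms G U) (morph_conj G)"
proof -
  interpret G: group G by fact
  note conj = morph_conj_graph[OF assms]
  have S: "p \<in> carrier G" if "x \<in> U_morphisms G U" "(p, u) \<in> morph_graph G x" for x p u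
    using partial_epi_morph_graph[OF assms that(1)] that(2) DirProd_subgroupD(1)[OF assms]
    unfolding partial_epi_def by blast
  show ?thesis
  proof
    show "morph_conj G a x \<in> U_morphisms G U" if "a \<in> carrier G" "x \<in> U_morphisms G U" for a x
      using that conj(1) by simp
    show "morph_conj G \<one>\<^bsub>G\<^esub> x = x" if x: "x \<in> U_morphisms G U" for x
    proof (rule inj_onD[OF inj_on_morph_graph[OF assms]])
      have "(q, u) \<in> graph_conj G \<one>\<^bsub>G\<^esub> (morph_graph G x) \<longleftrightarrow> (q, u) \<in> morph_graph G x" for q u
        using S[OF x] by (auto simp: mem_graph_conj)
      then show "morph_graph G (morph_conj G \<one>\<^bsub>G\<^esub> x) = morph_graph G x"
        using conj(2)[OF x G.one_closed] by auto
    qed (use x conj(1) in auto)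
    show "morph_conj G b (morph_conj G a x) = morph_conj G (a \<otimes>\<^bsub>G\<^esub> b) x"
      if ab: "a \<in> carrier G" "b \<in> carrier G" and x: "x \<in> U_morphisms G U" for a b x
    proof (rule inj_onD[OF inj_on_morph_graph[OF assms]])
      have "(q, u) \<in> graph_conj G b (graph_conj G a (morph_graph G x)) \<longleftrightarrow>
        (q, u) \<in> graph_conj G (a \<otimes>\<^bsub>G\<^esub> b) (morph_graph G x)" for q u
        using S[OF x] G.conj_conj[OF ab] by (auto simp: mem_graph_conj)
      then show "morph_graph G (morph_conj G b (morph_conj G a x)) =
        morph_graph G (morph_conj G (a \<otimes>\<^bsub>G\<^esub> b) x)"
        using conj ab x by auto
    qed (use x ab conj(1) in auto)
  qed
qed

section \<open>Automorphisms of \<open>U\<close>\<close>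

lemma mem_auto_iff: "\<alpha> \<in> auto U \<longleftrightarrow> \<alpha> \<in> iso U U \<and> \<alpha> \<in> extensional (carrier U)"
  by (auto simp: auto_def iso_def Bij_def)

lemma morph_aut_U_morphisms:
  assumes "x \<in> U_morphisms G U" "\<alpha> \<in> iso U V"
  shows "morph_aut G \<alpha> x \<in> U_morphisms G V"
proof -
  obtain P K \<theta> where x: "x = (P, K, \<theta>)" by (cases x)
  have sec: "is_section G P K" and iso: "\<theta> \<in> iso (quot G P K) U"
    using assms(1) by (auto simp: x U_morphisms_def)
  have "compose (carrier (quot G P K)) \<alpha> \<theta> \<in> iso (quot G P K) V"
    using group.iso_eq[OF group_quot[OF sec] iso_set_trans[OF iso assms(2)]]
    by (simp add: compose_def)
  then show ?thesis using sec by (simp add: x U_morphisms_def)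
qed

lemma mem_morph_graph_aut:
  "(p, v) \<in> morph_graph G (morph_aut G \<alpha> x) \<longleftrightarrow> (\<exists>u. (p, u) \<in> morph_graph G x \<and> v = \<alpha> u)"
  by (cases x) (auto simp: compose_def carrier_quot)

text \<open>Conjugation changes the first coordinate of the graph and \<open>\<alpha>\<close> the
  second, so the order does not matter.\<close>

lemma morph_conj_aut:
  assumes "group G" "group U" "group V" "x \<in> U_morphisms G U" "\<alpha> \<in> iso U V" "a \<in> carrier G"
  shows "morph_conj G a (morph_aut G \<alpha> x) = morph_aut G \<alpha> (morph_conj G a x)"
proof (rule inj_onD[OF inj_on_morph_graph[OF assms(1,3)]])
  note x = morph_conj_graph[OF assms(1,2,4,6)]
  note y = morph_conj_graph[OF assms(1,3) morph_aut_U_morphisms[OF assms(4,5)] assms(6)]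
  show "morph_conj G a (morph_aut G \<alpha> x) \<in> U_morphisms G V"
    "morph_aut G \<alpha> (morph_conj G a x) \<in> U_morphisms G V"
    using x y morph_aut_U_morphisms[OF x(1) assms(5)] by auto
  have "(q, v) \<in> morph_graph G (morph_conj G a (morph_aut G \<alpha> x)) \<longleftrightarrow>
    (q, v) \<in> morph_graph G (morph_aut G \<alpha> (morph_conj G a x))" for q v
    unfolding y(2) mem_morph_graph_aut x(2) mem_graph_conj by blast
  then show "morph_graph G (morph_conj G a (morph_aut G \<alpha> x)) =
    morph_graph G (morph_aut G \<alpha> (morph_conj G a x))"
    by auto
qed

lemma morph_aut_compose:
  assumes "x \<in> U_morphisms G U"
  shows "morph_aut G (compose (carrier U) \<beta> \<alpha>) x = morph_aut G \<beta> (morph_aut G \<alpha> x)"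
proof -
  obtain P K \<theta> where x: "x = (P, K, \<theta>)" by (cases x)
  have "\<theta> X \<in> carrier U" if "X \<in> carrier (quot G P K)" for X
    using assms that by (auto simp: x U_morphisms_def iso_def dest: hom_in_carrier)
  then show ?thesis by (auto simp: x compose_def)
qed

lemma Inn_subset_auto:
  assumes "group U"
  shows "Inn U \<subseteq> auto U"
proof
  interpret group U by fact
  fix \<iota> assume "\<iota> \<in> Inn U"
  then obtain v where v: "v \<in> carrier U"
    and \<iota>: "\<iota> = (\<lambda>x\<in>carrier U. inv\<^bsub>U\<^esub> v \<otimes>\<^bsub>U\<^esub> x \<otimes>\<^bsub>U\<^esub> v)"
    by (auto simp: Inn_def)
  have "\<iota> \<in> hom U U"
    using v conj_mult[OF v] by (auto simp: \<iota> intro!: homI)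
  moreover have "bij_betw \<iota> (carrier U) (carrier U)"
    by (rule bij_betw_byWitness[where f' = "\<lambda>x. inv\<^bsub>U\<^esub> (inv\<^bsub>U\<^esub> v) \<otimes>\<^bsub>U\<^esub> x \<otimes>\<^bsub>U\<^esub> inv\<^bsub>U\<^esub> v"])
      (use v conj_conj_inv[OF v] conj_conj_inv[of "inv\<^bsub>U\<^esub> v"] in \<open>auto simp: \<iota>\<close>)
  ultimately show "\<iota> \<in> auto U" by (simp add: mem_auto_iff iso_def) (simp add: \<iota>)
qed

lemma Inn_one:
  assumes "group U"
  shows "(\<lambda>x\<in>carrier U. x) \<in> Inn U"
proof -
  interpret group U by fact
  have "(\<lambda>x\<in>carrier U. x) = (\<lambda>x\<in>carrier U. inv\<^bsub>U\<^esub> \<one>\<^bsub>U\<^esub> \<otimes>\<^bsub>U\<^esub> x \<otimes>\<^bsub>U\<^esub> \<one>\<^bsub>U\<^esub>)"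
    by (auto simp: fun_eq_iff)
  then show ?thesis unfolding Inn_def by blast
qed

text \<open>If \<open>\<iota>\<close> is conjugation by \<open>v\<close> and \<open>q\<close> is a preimage of \<open>v\<close> under \<open>x\<close>, then \<open>a = q\<inverse>\<close> works.\<close>

lemma morph_aut_Inn:
  assumes "group G" "group U" "x \<in> U_morphisms G U" "\<iota> \<in> Inn U"
  obtains a where "a \<in> carrier G" "morph_aut G \<iota> x = morph_conj G a x"
proof -
  interpret G: group G by fact
  interpret U: group U by fact
  obtain v where v: "v \<in> carrier U"
    and \<iota>: "\<iota> = (\<lambda>x\<in>carrier U. inv\<^bsub>U\<^esub> v \<otimes>\<^bsub>U\<^esub> x \<otimes>\<^bsub>U\<^esub> v)"
    using assms(4) by (auto simp: Inn_def)
  let ?S = "morph_graph G x"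
  have epi: "subgroup ?S (G \<times>\<times> U)" "Range ?S = carrier U"
    using partial_epi_morph_graph[OF assms(1-3)] by (auto simp: partial_epi_def)
  note S = DirProd_subgroupD[OF assms(1,2) epi(1)]
  obtain q where q: "(q, v) \<in> ?S" using v epi(2) by blast
  have qG: "q \<in> carrier G" using S(1)[OF q] .
  have *: "(p, w) \<in> graph_conj G (inv\<^bsub>G\<^esub> q) ?S \<longleftrightarrow> (p, w) \<in> morph_graph G (morph_aut G \<iota> x)"
    for p w
  proof
    assume "(p, w) \<in> graph_conj G (inv\<^bsub>G\<^esub> q) ?S"
    then obtain r where r: "(r, w) \<in> ?S"
      "p = inv\<^bsub>G\<^esub> (inv\<^bsub>G\<^esub> q) \<otimes>\<^bsub>G\<^esub> r \<otimes>\<^bsub>G\<^esub> inv\<^bsub>G\<^esub> q"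
      by (auto simp: mem_graph_conj)
    \<comment> \<open>This is \<open>v w v\<inverse>\<close>, the element that
      \<open>\<iota>\<close> sends to \<open>w\<close>. The double inverse is kept so that it
      matches the second coordinate of the product formed in \<open>S\<close>.\<close>
    let ?u = "inv\<^bsub>U\<^esub> (inv\<^bsub>U\<^esub> v) \<otimes>\<^bsub>U\<^esub> w \<otimes>\<^bsub>U\<^esub> inv\<^bsub>U\<^esub> v"
    have w: "w \<in> carrier U" using S(2)[OF r(1)] .
    have "(p, ?u) \<in> ?S"
      unfolding r(2) using S(4)[OF S(4)[OF S(5)[OF S(5)[OF q]] r(1)] S(5)[OF q]] .
    moreover have "\<iota> ?u = w"
      using U.conj_conj_inv[of "inv\<^bsub>U\<^esub> v" w] v w by (simp add: \<iota>)
    ultimately show "(p, w) \<in> morph_graph G (morph_aut G \<iota> x)"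
      unfolding mem_morph_graph_aut by (intro exI[of _ ?u]) simp
  next
    assume "(p, w) \<in> morph_graph G (morph_aut G \<iota> x)"
    then obtain u where u: "(p, u) \<in> ?S" "w = \<iota> u" unfolding mem_morph_graph_aut by blast
    then have "(inv\<^bsub>G\<^esub> q \<otimes>\<^bsub>G\<^esub> p \<otimes>\<^bsub>G\<^esub> q, w) \<in> ?S"
      using S(4)[OF S(4)[OF S(5)[OF q] u(1)] q] S(2)[OF u(1)] by (simp add: \<iota>)
    moreover have "inv\<^bsub>G\<^esub> (inv\<^bsub>G\<^esub> q) \<otimes>\<^bsub>G\<^esub> (inv\<^bsub>G\<^esub> q \<otimes>\<^bsub>G\<^esub> p \<otimes>\<^bsub>G\<^esub> q) \<otimes>\<^bsub>G\<^esub> inv\<^bsub>G\<^esub> q = p"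
      using G.conj_conj_inv[OF qG S(1)[OF u(1)]] .
    ultimately show "(p, w) \<in> graph_conj G (inv\<^bsub>G\<^esub> q) ?S"
      unfolding mem_graph_conj by metis
  qed
  have \<iota>': "\<iota> \<in> iso U U" using assms(4) Inn_subset_auto[OF assms(2)] mem_auto_iff by blast
  have "morph_aut G \<iota> x = morph_conj G (inv\<^bsub>G\<^esub> q) x"
  proof (rule inj_onD[OF inj_on_morph_graph[OF assms(1,2)]])
    have "morph_graph G (morph_aut G \<iota> x) = graph_conj G (inv\<^bsub>G\<^esub> q) ?S"
      using * by (auto simp del: morph_graph.simps)
    then show "morph_graph G (morph_aut G \<iota> x) = morph_graph G (morph_conj G (inv\<^bsub>G\<^esub> q) x)"
      using morph_conj_graph(2)[OF assms(1-3)] qG by simp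
  qed (use morph_conj_graph(1)[OF assms(1-3)] morph_aut_U_morphisms[OF assms(3) \<iota>'] qG in simp_all)
  then show ?thesis using that qG by blast
qed

abbreviation morph_class ::
    "('a, 'm) monoid_scheme \<Rightarrow> ('a, 'u) morph \<Rightarrow> ('a, 'u) morph set" where
  "morph_class G \<equiv> orbit G (morph_conj G)"

section \<open>Cosets of inner automorphisms and the action of \<open>Out U\<close> on
  classes\<close>

lemma carrier_Out: "carrier (Out U) = (\<lambda>\<alpha>. Inn U #>\<^bsub>AutoGroup U\<^esub> \<alpha>) ` auto U"
  by (simp add: Out_def carrier_FactGroup AutoGroup_def)

text \<open>The members of this coset apply \<open>\<alpha>\<close> before the inner automorphism.
  The inner factor thus acts on a morphism onto \<open>U\<close> last, where
  \<open>morph_aut_Inn\<close> can turn it into a conjugation in \<open>G\<close>.\<close>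

lemma Inn_coset:
  assumes "group U" "\<alpha> \<in> auto U"
  shows "Inn U #>\<^bsub>AutoGroup U\<^esub> \<alpha> = (\<lambda>\<iota>. compose (carrier U) \<iota> \<alpha>) ` Inn U"
proof -
  have "\<iota> \<otimes>\<^bsub>AutoGroup U\<^esub> \<alpha> = compose (carrier U) \<iota> \<alpha>" if "\<iota> \<in> Inn U" for \<iota>
    using that assms(2) Inn_subset_auto[OF assms(1)]
    by (auto simp: AutoGroup_def BijGroup_def auto_def)
  then show ?thesis by (auto simp: r_coset_def)
qed

text \<open>The set of all products in \<open>out_class\<close> is a single class: an inner factor
  only moves a morphism within its class, and conversely the class is reached with the identity as
  inner factor.\<close>

lemma out_class_coset:
  assumes "group G" "group U" "x \<in> U_morphisms G U" "\<alpha> \<in> auto U"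
  shows "out_class G (Inn U #>\<^bsub>AutoGroup U\<^esub> \<alpha>) (morph_class G x) = morph_class G (morph_aut G \<alpha> x)"
proof -
  interpret G: right_action G "U_morphisms G U" "morph_conj G"
    by (rule right_action_morph_conj[OF assms(1,2)])
  have \<alpha>: "\<alpha> \<in> iso U U" "\<alpha> \<in> extensional (carrier U)" using assms(4) by (simp_all add: mem_auto_iff)
  note x\<alpha> = morph_aut_U_morphisms[OF assms(3) \<alpha>(1)]
  have comm: "morph_aut G \<alpha> (morph_conj G a x) = morph_conj G a (morph_aut G \<alpha> x)"
    if "a \<in> carrier G" for a
    using morph_conj_aut[OF assms(1,2,2,3) \<alpha>(1) that] by simp
  show ?thesis
  proof (intro equalityI subsetI)
    fix z assume "z \<in> out_class G (Inn U #>\<^bsub>AutoGroup U\<^esub> \<alpha>) (morph_class G x)"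
    then obtain \<iota> a where \<iota>: "\<iota> \<in> Inn U" and a: "a \<in> carrier G"
      and z: "z = morph_aut G (compose (carrier U) \<iota> \<alpha>) (morph_conj G a x)"
      unfolding out_class_def Inn_coset[OF assms(2,4)] orbit_def by blast
    have "z = morph_aut G \<iota> (morph_conj G a (morph_aut G \<alpha> x))"
      using z morph_aut_compose[OF G.closed[OF a assms(3)]] comm[OF a] by simp
    then obtain b where "b \<in> carrier G" "z = morph_conj G b (morph_conj G a (morph_aut G \<alpha> x))"
      using morph_aut_Inn[OF assms(1,2) G.closed[OF a x\<alpha>] \<iota>] by metis
    then show "z \<in> morph_class G (morph_aut G \<alpha> x)"
      using G.act_mult[OF a _ x\<alpha>] a by (auto simp: orbit_def)
  next
    fix z assume "z \<in> morph_class G (morph_aut G \<alpha> x)"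
    then obtain a where a: "a \<in> carrier G" "z = morph_aut G \<alpha> (morph_conj G a x)"
      using comm by (auto simp: orbit_def)
    have "compose (carrier U) (\<lambda>u\<in>carrier U. u) \<alpha> = \<alpha>"
      using \<alpha> by (intro Id_compose) (auto simp: iso_def hom_def)
    then have "\<alpha> \<in> Inn U #>\<^bsub>AutoGroup U\<^esub> \<alpha>"
      unfolding Inn_coset[OF assms(2,4)] using Inn_one[OF assms(2)] by (metis imageI)
    then show "z \<in> out_class G (Inn U #>\<^bsub>AutoGroup U\<^esub> \<alpha>) (morph_class G x)"
      unfolding out_class_def orbit_def using a by blast
  qed
qed

text \<open>Every element of \<open>Out U\<close> is the coset of some \<open>\<alpha>\<close> and
  acts as \<open>\<alpha>\<close> does, so cosets can be replaced by automorphisms. The same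
  \<open>\<alpha>\<close> acts on both components.\<close>

lemma Out_orbit:
  fixes G1 :: "('a, 'm) monoid_scheme" and G2 :: "('b, 'n) monoid_scheme"
    and U :: "('u, 'k) monoid_scheme"
  assumes "group G1" "group G2" "group U" "x \<in> U_morphisms G1 U" "y \<in> U_morphisms G2 U"
  shows "orbit (Out U) (diag_action (out_class G1) (out_class G2)) (morph_class G1 x, morph_class G2 y) =
    (\<lambda>\<alpha>. (morph_class G1 (morph_aut G1 \<alpha> x), morph_class G2 (morph_aut G2 \<alpha> y))) ` auto U"
proof -
  have "orbit (Out U) \<phi> z = (\<lambda>\<alpha>. \<phi> (Inn U #>\<^bsub>AutoGroup U\<^esub> \<alpha>) z) ` auto U"
    for \<phi> and z :: "('a, 'u) morph set \<times> ('b, 'u) morph set"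
    unfolding orbit_def carrier_Out by blast
  then show ?thesis
    using out_class_coset[OF assms(1,3,4)] out_class_coset[OF assms(2,3,5)]
    by (simp add: diag_action_def)
qed

text \<open>One morphism suffices to make \<open>U\<close> finite, as the image of a finite
  quotient; all graphs then lie in a finite set. If there is no morphism, the claim is trivial even
  for infinite \<open>U\<close>.\<close>

lemma finite_U_morphisms:
  assumes "group G" "group U" "finite (carrier G)"
  shows "finite (U_morphisms G U)"
proof (cases "U_morphisms G U = {}")
  case False
  then obtain x where x: "x \<in> U_morphisms G U" by blast
  have sub: "morph_graph G z \<subseteq> carrier G \<times> carrier U" if "z \<in> U_morphisms G U" for z
    using partial_epi_morph_graph[OF assms(1,2) that] subgroup.subset
    by (fastforce simp: partial_epi_def)
  obtain P K \<theta> where "x = (P, K, \<theta>)" by (cases x)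
  with x have sec: "is_section G P K" and iso: "\<theta> \<in> iso (quot G P K) U"
    by (auto simp: U_morphisms_def)
  have "finite P" using is_section_subgroups(1)[OF assms(1) sec] assms(3)
    by (meson finite_subset subgroup.subset)
  then have "finite (carrier U)"
    using iso by (metis carrier_quot finite_imageI iso_iff)
  then have "finite (Pow (carrier G \<times> carrier U))" using assms(3) by simp
  moreover have "morph_graph G ` U_morphisms G U \<subseteq> Pow (carrier G \<times> carrier U)"
    using sub by blast
  ultimately show ?thesis
    using inj_on_morph_graph[OF assms(1,2)] by (meson finite_imageD finite_subset)
qed simp

section \<open>Goursat correspondence\<close>

text \<open>Since \<open>\<psi>\<close> is a bijection from the cosets onto \<open>U\<close>,
  applying it removes \<open>inv_into\<close>: the equation of cosets becomes an equation of values
  in \<open>U\<close>.\<close>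

lemma mem_quotient_graph:
  assumes "x \<in> U_morphisms G1 U" "y \<in> U_morphisms G2 U"
  shows "(a, b) \<in> quotient_graph G1 G2 x y \<longleftrightarrow>
    (\<exists>u. (a, u) \<in> morph_graph G1 x \<and> (b, u) \<in> morph_graph G2 y)"
proof -
  obtain P K \<theta> Q L \<psi> where x: "x = (P, K, \<theta>)" and y: "y = (Q, L, \<psi>)"
    by (cases x; cases y)
  have onto: "\<theta> ` carrier (quot G1 P K) = carrier U" "\<psi> ` carrier (quot G2 Q L) = carrier U"
    and inj: "inj_on \<psi> (carrier (quot G2 Q L))"
    using assms by (auto simp: x y U_morphisms_def iso_iff)
  have "inv_into (carrier (quot G2 Q L)) \<psi> (\<theta> (K #>\<^bsub>G1\<^esub> a)) = L #>\<^bsub>G2\<^esub> b \<longleftrightarrow>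
    \<theta> (K #>\<^bsub>G1\<^esub> a) = \<psi> (L #>\<^bsub>G2\<^esub> b)" if "a \<in> P" "b \<in> Q"
  proof -
    have "\<theta> (K #>\<^bsub>G1\<^esub> a) \<in> \<psi> ` carrier (quot G2 Q L)" "L #>\<^bsub>G2\<^esub> b \<in> carrier (quot G2 Q L)"
      using onto that by (auto simp: carrier_quot)
    then show ?thesis using inj by (metis f_inv_into_f inv_into_f_f)
  qed
  then show ?thesis by (auto simp: x y iso_graph_def)
qed

lemma quotient_graph_eq_relcomp:
  assumes "x \<in> U_morphisms G1 U" "y \<in> U_morphisms G2 U"
  shows "quotient_graph G1 G2 x y = morph_graph G1 x O (morph_graph G2 y)\<inverse>"
  using mem_quotient_graph[OF assms] by auto

lemma subgroup_quotient_graph: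
  assumes "group G1" "group G2" "group U" "x \<in> U_morphisms G1 U" "y \<in> U_morphisms G2 U"
  shows "subgroup (quotient_graph G1 G2 x y) (G1 \<times>\<times> G2)"
  unfolding quotient_graph_eq_relcomp[OF assms(4,5)]
  using subgroup_relcomp[OF assms(1,3,2)] subgroup_converse[OF assms(2,3)]
    partial_epi_morph_graph[OF assms(1,3,4)] partial_epi_morph_graph[OF assms(2,3,5)]
  by (simp add: partial_epi_def)

text \<open>Conjugation by \<open>(a, b)\<close> affects the two outer coordinates and leaves the
  common value in \<open>U\<close> alone.\<close>

lemma quotient_graph_conj:
  assumes "group G1" "group G2" "group U" "x \<in> U_morphisms G1 U" "y \<in> U_morphisms G2 U"
    and "a \<in> carrier G1" "b \<in> carrier G2"
  shows "conj_set (G1 \<times>\<times> G2) (a, b) (quotient_graph G1 G2 x y) =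
    quotient_graph G1 G2 (morph_conj G1 a x) (morph_conj G2 b y)"
proof -
  note x = morph_conj_graph[OF assms(1,3,4,6)] and y = morph_conj_graph[OF assms(2,3,5,7)]
  have "(p, q) \<in> conj_set (G1 \<times>\<times> G2) (a, b) (quotient_graph G1 G2 x y) \<longleftrightarrow>
    (\<exists>p' q'. (p', q') \<in> quotient_graph G1 G2 x y \<and> p = inv\<^bsub>G1\<^esub> a \<otimes>\<^bsub>G1\<^esub> p' \<otimes>\<^bsub>G1\<^esub> a \<and>
      q = inv\<^bsub>G2\<^esub> b \<otimes>\<^bsub>G2\<^esub> q' \<otimes>\<^bsub>G2\<^esub> b)" for p q
    using inv_DirProd[OF assms(1,2,6,7)]
    by (auto simp: conj_set_eq image_iff Bex_def simp del: quotient_graph.simps)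
  then have "(p, q) \<in> conj_set (G1 \<times>\<times> G2) (a, b) (quotient_graph G1 G2 x y) \<longleftrightarrow>
    (p, q) \<in> quotient_graph G1 G2 (morph_conj G1 a x) (morph_conj G2 b y)" for p q
    unfolding mem_quotient_graph[OF x(1) y(1)] mem_quotient_graph[OF assms(4,5)] x(2) y(2)
      mem_graph_conj by blast
  then show ?thesis by auto
qed

text \<open>An isomorphism only renames the common value \<open>u\<close>; injectivity ensures that
  no new coincidences of values arise.\<close>

lemma quotient_graph_aut:
  assumes "group G1" "group G2" "group U" "x \<in> U_morphisms G1 U" "y \<in> U_morphisms G2 U"
    and "\<alpha> \<in> iso U V"
  shows "quotient_graph G1 G2 (morph_aut G1 \<alpha> x) (morph_aut G2 \<alpha> y) = quotient_graph G1 G2 x y"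
proof -
  note mem = mem_quotient_graph[OF morph_aut_U_morphisms[OF assms(4,6)]
      morph_aut_U_morphisms[OF assms(5,6)]]
  have "u \<in> carrier U" if "(a, u) \<in> morph_graph G1 x" for a u
    using that partial_epi_morph_graph[OF assms(1,3,4)] by (auto simp: partial_epi_def)
  moreover have "u \<in> carrier U" if "(a, u) \<in> morph_graph G2 y" for a u
    using that partial_epi_morph_graph[OF assms(2,3,5)] by (auto simp: partial_epi_def)
  moreover have "inj_on \<alpha> (carrier U)" using assms(6) by (simp add: iso_iff)
  ultimately have "(a, b) \<in> quotient_graph G1 G2 (morph_aut G1 \<alpha> x) (morph_aut G2 \<alpha> y) \<longleftrightarrow>
    (a, b) \<in> quotient_graph G1 G2 x y" for a b
    unfolding mem mem_quotient_graph[OF assms(4,5)] mem_morph_graph_aut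
    by (metis inj_onD)
  then show ?thesis by auto
qed

section \<open>Sections attached to a subgroup of the product\<close>

lemma goursat_quotient_graph:
  assumes "(P, K, \<theta>) \<in> U_morphisms G1 U" "(Q, L, \<psi>) \<in> U_morphisms G2 U"
  shows "goursat G1 G2 (quotient_graph G1 G2 (P, K, \<theta>) (Q, L, \<psi>)) P K Q L"
proof -
  have *: "is_section G1 P K" "is_section G2 Q L" "\<theta> \<in> iso (quot G1 P K) U" "\<psi> \<in> iso (quot G2 Q L) U"
    using assms by (auto simp: U_morphisms_def)
  then have "inv_into (carrier (quot G2 Q L)) \<psi> \<circ> \<theta> \<in> iso (quot G1 P K) (quot G2 Q L)"
    by (metis group.iso_set_sym group_quot iso_set_trans)
  with * show ?thesis by (auto simp: goursat_def)
qed

text \<open>Both sections are recovered from \<open>L\<close> alone, so the sections under the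
  existential quantifier in \<open>le_PK\<close> are determined. The kernels appear as fibres over
  the identities because \<open>\<theta>\<close> is injective with
  \<open>\<theta> K1 = K2\<close>.\<close>

lemma goursatD:
  assumes "group G1" "group G2" "goursat G1 G2 L P1 K1 P2 K2"
  shows "P1 = Domain L" "K1 = {a. (a, \<one>\<^bsub>G2\<^esub>) \<in> L}" "P2 = Range L" "K2 = {b. (\<one>\<^bsub>G1\<^esub>, b) \<in> L}"
    "is_section G1 P1 K1" "is_section G2 P2 K2"
proof -
  show sec: "is_section G1 P1 K1" "is_section G2 P2 K2"
    using assms(3) by (auto simp: goursat_def)
  obtain \<theta> where iso: "\<theta> \<in> iso (quot G1 P1 K1) (quot G2 P2 K2)"
    and L: "L = iso_graph G1 G2 P1 K1 P2 K2 \<theta>"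
    using assms(3) by (auto simp: goursat_def)
  have onto: "\<theta> ` carrier (quot G1 P1 K1) = carrier (quot G2 P2 K2)"
    and inj: "inj_on \<theta> (carrier (quot G1 P1 K1))"
    using iso by (auto simp: iso_iff)
  have \<theta>1: "\<theta> K1 = K2"
    using iso hom_one[of \<theta> "quot G1 P1 K1" "quot G2 P2 K2"] group_quot[OF sec(1)]
      group_quot[OF sec(2)] by (simp add: iso_iff)
  note sg1 = is_section_subgroups[OF assms(1) sec(1)] and sg2 = is_section_subgroups[OF assms(2) sec(2)]
  note one1 = coset_one[OF assms(1) sg1(2)] and one2 = coset_one[OF assms(2) sg2(2)]
  have ones: "\<one>\<^bsub>G1\<^esub> \<in> P1" "\<one>\<^bsub>G2\<^esub> \<in> P2"
    using sg1(1) sg2(1) by (simp_all add: subgroup.one_closed)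
  interpret G1: group G1 by fact
  interpret G2: group G2 by fact
  have K1: "K1 #>\<^bsub>G1\<^esub> a = K1 \<longleftrightarrow> a \<in> K1" if "a \<in> P1" for a
    using coset_eq_iff[OF assms(1) sg1(2), of a "\<one>\<^bsub>G1\<^esub>"] that sg1(1)
    by (simp add: one1 subgroup.mem_carrier)
  have K2: "K2 #>\<^bsub>G2\<^esub> b = K2 \<longleftrightarrow> b \<in> K2" if "b \<in> P2" for b
    using coset_eq_iff[OF assms(2) sg2(2), of b "\<one>\<^bsub>G2\<^esub>"] that sg2(1)
    by (simp add: one2 subgroup.mem_carrier)
  have mem: "(a, b) \<in> L \<longleftrightarrow> a \<in> P1 \<and> b \<in> P2 \<and> \<theta> (K1 #>\<^bsub>G1\<^esub> a) = K2 #>\<^bsub>G2\<^esub> b" for a b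
    by (auto simp: L iso_graph_def)
  have "\<exists>b. (a, b) \<in> L" if "a \<in> P1" for a
  proof -
    have "\<theta> (K1 #>\<^bsub>G1\<^esub> a) \<in> carrier (quot G2 P2 K2)" using onto that by (auto simp: carrier_quot)
    then show ?thesis using that by (auto simp: mem carrier_quot)
  qed
  then show "P1 = Domain L" using mem by blast
  have "\<exists>a. (a, b) \<in> L" if "b \<in> P2" for b
  proof -
    have "K2 #>\<^bsub>G2\<^esub> b \<in> \<theta> ` carrier (quot G1 P1 K1)"
      unfolding onto using that by (simp add: carrier_quot)
    then show ?thesis using that by (auto simp: mem carrier_quot)
  qed
  then show "P2 = Range L" using mem by blast
  have "\<theta> (K1 #>\<^bsub>G1\<^esub> a) = K2 \<longleftrightarrow> a \<in> K1" if "a \<in> P1" for a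
  proof -
    have "K1 \<in> carrier (quot G1 P1 K1)" "K1 #>\<^bsub>G1\<^esub> a \<in> carrier (quot G1 P1 K1)"
      using one1 ones(1) that by (auto simp: carrier_quot image_iff)
    then show ?thesis using K1[OF that] inj \<theta>1 by (metis inj_onD)
  qed
  then show "K1 = {a. (a, \<one>\<^bsub>G2\<^esub>) \<in> L}"
    using sg1(3) ones by (auto simp: mem one2)
  show "K2 = {b. (\<one>\<^bsub>G1\<^esub>, b) \<in> L}"
    using sg2(3) ones K2 by (auto simp: mem one1 \<theta>1)
qed

text \<open>Injectivity of the canonical map gives the first conclusion and surjectivity the second,
  which says \<open>P = K P'\<close>.\<close>

lemma canonical_isoD:
  assumes "group G" "is_section G P' K'" "is_section G P K" "P' \<subseteq> P" "canonical_iso G P' K' P K"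
  shows "P' \<inter> K \<subseteq> K'" "\<And>p. p \<in> P \<Longrightarrow> \<exists>p'\<in>P'. p \<otimes>\<^bsub>G\<^esub> inv\<^bsub>G\<^esub> p' \<in> K"
proof -
  obtain f where f: "f \<in> iso (quot G P' K') (quot G P K)"
    "\<And>p. p \<in> P' \<Longrightarrow> f (K' #>\<^bsub>G\<^esub> p) = K #>\<^bsub>G\<^esub> p"
    using assms(5) by (auto simp: canonical_iso_def)
  interpret group G by fact
  note sg' = is_section_subgroups[OF assms(1,2)] and sg = is_section_subgroups[OF assms(1,3)]
  have sub: "P \<subseteq> carrier G" using sg(1) subgroup.subset by blast
  show "P' \<inter> K \<subseteq> K'"
  proof
    fix p assume p: "p \<in> P' \<inter> K"
    have one: "\<one>\<^bsub>G\<^esub> \<in> P'" using sg'(1) subgroup.one_closed by blast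
    have pG: "p \<in> carrier G" using p sub assms(4) by blast
    have "K #>\<^bsub>G\<^esub> p = K #>\<^bsub>G\<^esub> \<one>\<^bsub>G\<^esub>"
      using coset_eq_iff[OF assms(1) sg(2) pG one_closed] p pG by simp
    then have "f (K' #>\<^bsub>G\<^esub> p) = f (K' #>\<^bsub>G\<^esub> \<one>\<^bsub>G\<^esub>)"
      using f(2) p one by simp
    moreover have "inj_on f (carrier (quot G P' K'))" using f(1) by (simp add: iso_iff)
    ultimately have "K' #>\<^bsub>G\<^esub> p = K' #>\<^bsub>G\<^esub> \<one>\<^bsub>G\<^esub>"
      using p one by (auto simp: carrier_quot dest: inj_onD)
    then show "p \<in> K'"
      using coset_eq_iff[OF assms(1) sg'(2) pG one_closed] pG by simp
  qed
  fix p assume p: "p \<in> P"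
  have "K #>\<^bsub>G\<^esub> p \<in> f ` carrier (quot G P' K')"
    using f(1) p by (simp add: iso_iff carrier_quot)
  then obtain p' where "p' \<in> P'" "K #>\<^bsub>G\<^esub> p = K #>\<^bsub>G\<^esub> p'"
    using f(2) by (auto simp: carrier_quot)
  then show "\<exists>p'\<in>P'. p \<otimes>\<^bsub>G\<^esub> inv\<^bsub>G\<^esub> p' \<in> K"
    using coset_eq_iff[OF assms(1) sg(2)] p sub assms(4) by blast
qed

section \<open>Fibres and compositions of subgroups of direct products\<close>

lemma DirProd_subgroup_div:
  assumes "group G" "group H" "subgroup S (G \<times>\<times> H)" "(a, b) \<in> S" "(c, d) \<in> S"
  shows "(a \<otimes>\<^bsub>G\<^esub> inv\<^bsub>G\<^esub> c, b \<otimes>\<^bsub>H\<^esub> inv\<^bsub>H\<^esub> d) \<in> S"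
  using DirProd_subgroupD[OF assms(1-3)] assms(4,5) by simp

text \<open>The fibre over \<open>b\<close> is the coset through \<open>c\<close> of the fibre over
  the identity. Membership can thus be transferred between points with the same second
  coordinate.\<close>

lemma DirProd_subgroup_fibre:
  assumes "group G" "group H" "subgroup S (G \<times>\<times> H)" "(c, b) \<in> S" "a \<in> carrier G"
  shows "(a, b) \<in> S \<longleftrightarrow> (a \<otimes>\<^bsub>G\<^esub> inv\<^bsub>G\<^esub> c, \<one>\<^bsub>H\<^esub>) \<in> S"
proof -
  interpret G: group G by fact
  interpret H: group H by fact
  note S = DirProd_subgroupD[OF assms(1-3)]
  have c: "c \<in> carrier G" "b \<in> carrier H" using S(1,2) assms(4) by blast+
  show ?thesis
  proof
    assume "(a, b) \<in> S"
    from DirProd_subgroup_div[OF assms(1-3) this assms(4)] show "(a \<otimes>\<^bsub>G\<^esub> inv\<^bsub>G\<^esub> c, \<one>\<^bsub>H\<^esub>) \<in> S"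
      using c by simp
  next
    assume "(a \<otimes>\<^bsub>G\<^esub> inv\<^bsub>G\<^esub> c, \<one>\<^bsub>H\<^esub>) \<in> S"
    from S(4)[OF this assms(4)] show "(a, b) \<in> S"
      using c assms(5) by (simp add: G.m_assoc)
  qed
qed

lemma partial_epi_unique_iff:
  assumes "group G" "group U" "partial_epi G U S" "(a, u) \<in> S" "(b, v) \<in> S"
  shows "u = v \<longleftrightarrow> (a \<otimes>\<^bsub>G\<^esub> inv\<^bsub>G\<^esub> b, \<one>\<^bsub>U\<^esub>) \<in> S"
proof -
  have sub: "subgroup S (G \<times>\<times> U)" and sv: "single_valued S"
    using assms(3) by (auto simp: partial_epi_def)
  note S = DirProd_subgroupD[OF assms(1,2) sub]
  show ?thesis
    using DirProd_subgroup_fibre[OF assms(1,2) sub assms(5) S(1)[OF assms(4)]] assms(4) sv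
    by (auto dest: single_valuedD)
qed

text \<open>This produces the morphisms with graphs \<open>L O S2'\<close> and
  \<open>L\<inverse> O S1'\<close>. Two values at \<open>a\<close> come from elements
  \<open>b\<close> and \<open>c\<close> whose quotient lies over the identity in \<open>L\<close>;
  the last hypothesis puts this quotient into the kernel of \<open>S\<close>, so the values agree.
  The condition on domains gives surjectivity.\<close>

lemma partial_epi_relcomp:
  assumes "group G" "group H" "group U" "subgroup L (G \<times>\<times> H)" "partial_epi H U S"
    and "Domain S \<subseteq> Range L"
    and "\<And>b. b \<in> Domain S \<Longrightarrow> (\<one>\<^bsub>G\<^esub>, b) \<in> L \<Longrightarrow> (b, \<one>\<^bsub>U\<^esub>) \<in> S"
  shows "partial_epi G U (L O S)"
proof -
  interpret G: group G by fact
  have sub: "subgroup S (H \<times>\<times> U)" and ran: "Range S = carrier U"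
    using assms(5) by (auto simp: partial_epi_def)
  have "single_valued (L O S)"
  proof (rule single_valuedI)
    fix a u v assume "(a, u) \<in> L O S" "(a, v) \<in> L O S"
    then obtain b c where bc: "(a, b) \<in> L" "(b, u) \<in> S" "(a, c) \<in> L" "(c, v) \<in> S" by blast
    have "(\<one>\<^bsub>G\<^esub>, b \<otimes>\<^bsub>H\<^esub> inv\<^bsub>H\<^esub> c) \<in> L"
      using DirProd_subgroup_div[OF assms(1,2,4) bc(1,3)]
        DirProd_subgroupD(1)[OF assms(1,2,4) bc(1)] by simp
    moreover have "b \<otimes>\<^bsub>H\<^esub> inv\<^bsub>H\<^esub> c \<in> Domain S"
      using DirProd_subgroup_div[OF assms(2,3) sub bc(2,4)] by blast
    ultimately show "u = v"
      using assms(7) partial_epi_unique_iff[OF assms(2,3,5) bc(2,4)] by simp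
  qed
  moreover have "Range (L O S) = carrier U"
    using ran assms(6) by blast
  ultimately show ?thesis
    using subgroup_relcomp[OF assms(1-4) sub] by (simp add: partial_epi_def)
qed

text \<open>For normality, conjugating \<open>(k, \<one>)\<close> by an element
  \<open>(x, b)\<close> of \<open>L\<close> gives a pair in \<open>L\<close> whose second coordinate
  is again the identity.\<close>

lemma subgroup_section:
  assumes "group G1" "group G2" "subgroup L (G1 \<times>\<times> G2)"
  shows "is_section G1 (Domain L) {a. (a, \<one>\<^bsub>G2\<^esub>) \<in> L}"
proof -
  interpret G1: group G1 by fact
  interpret G2: group G2 by fact
  note L = DirProd_subgroupD[OF assms]
  let ?P = "Domain L" and ?K = "{a. (a, \<one>\<^bsub>G2\<^esub>) \<in> L}"
  have P: "subgroup ?P G1" by (rule subgroup_Domain[OF assms])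
  interpret P: group "G1\<lparr>carrier := ?P\<rparr>"
    by (rule subgroup.subgroup_is_group[OF P assms(1)])
  have "subgroup ?K (G1\<lparr>carrier := ?P\<rparr>)"
  proof (rule P.subgroupI)
    show "?K \<subseteq> carrier (G1\<lparr>carrier := ?P\<rparr>)" by auto
    show "?K \<noteq> {}" using L(3) by auto
    show "inv\<^bsub>G1\<lparr>carrier := ?P\<rparr>\<^esub> a \<in> ?K" if "a \<in> ?K" for a
      using that L(5)[of a "\<one>\<^bsub>G2\<^esub>"] G1.m_inv_consistent[OF P DomainI, of a] by simp
    show "a \<otimes>\<^bsub>G1\<lparr>carrier := ?P\<rparr>\<^esub> b \<in> ?K" if "a \<in> ?K" "b \<in> ?K" for a b
      using that L(4)[of a "\<one>\<^bsub>G2\<^esub>" b "\<one>\<^bsub>G2\<^esub>"] by simp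
  qed
  moreover have "x \<otimes>\<^bsub>G1\<^esub> k \<otimes>\<^bsub>G1\<^esub> inv\<^bsub>G1\<^esub> x \<in> ?K" if x: "x \<in> ?P" "k \<in> ?K" for x k
  proof -
    obtain b where b: "(x, b) \<in> L" using x by blast
    have "(k, \<one>\<^bsub>G2\<^esub>) \<in> L" using x by simp
    from DirProd_subgroup_div[OF assms L(4)[OF b this] b] show ?thesis
      using L(2)[OF b] by simp
  qed
  ultimately have "?K \<lhd> G1\<lparr>carrier := ?P\<rparr>"
    using G1.m_inv_consistent[OF P] by (simp add: P.normal_inv_iff)
  then show ?thesis using P by (simp add: is_section_def)
qed

text \<open>The existence half of Goursat's Lemma. The morphism \<open>x\<close> comes from the
  given isomorphism, and the graph of \<open>y\<close> must then be \<open>L\<inverse> O S\<close>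
  for the graph \<open>S\<close> of \<open>x\<close>. This is a \<open>partial_epi\<close> because
  the kernel of \<open>x\<close> is the fibre of \<open>L\<close> over the identity.\<close>

lemma ex_quotient_graph:
  assumes "group G1" "group G2" "group U" "subgroup L (G1 \<times>\<times> G2)"
    and "quot G1 (Domain L) {a. (a, \<one>\<^bsub>G2\<^esub>) \<in> L} \<cong> U"
  obtains x y where "x \<in> U_morphisms G1 U" "y \<in> U_morphisms G2 U" "quotient_graph G1 G2 x y = L"
proof -
  let ?P = "Domain L" and ?K = "{a. (a, \<one>\<^bsub>G2\<^esub>) \<in> L}"
  note sec = subgroup_section[OF assms(1,2,4)]
  obtain i where i: "i \<in> iso (quot G1 ?P ?K) U" using assms(5) by (auto simp: is_iso_def)
  define x where "x = (?P, ?K, restrict i (carrier (quot G1 ?P ?K)))"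
  have x: "x \<in> U_morphisms G1 U"
    using sec group.iso_eq[OF group_quot[OF sec] i] by (simp add: x_def U_morphisms_def)
  let ?S = "morph_graph G1 x"
  have epi: "partial_epi G1 U ?S" by (rule partial_epi_morph_graph[OF assms(1,3) x])
  then have S: "subgroup ?S (G1 \<times>\<times> U)" by (simp add: partial_epi_def)
  have dom: "Domain ?S = ?P" and ker: "(a, \<one>\<^bsub>U\<^esub>) \<in> ?S \<longleftrightarrow> (a, \<one>\<^bsub>G2\<^esub>) \<in> L" for a
    using morph_graph_kernel[OF assms(1,3) x[unfolded x_def]] unfolding x_def by blast+
  have "partial_epi G2 U (L\<inverse> O ?S)"
    by (rule partial_epi_relcomp[OF assms(2,1,3) subgroup_converse[OF assms(1,2,4)] epi])
      (use dom ker in auto)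
  then obtain y where y: "y \<in> U_morphisms G2 U" "morph_graph G2 y = L\<inverse> O ?S"
    by (rule ex_U_morphism[OF assms(2,3)])
  have "(a, b) \<in> quotient_graph G1 G2 x y \<longleftrightarrow> (a, b) \<in> L" for a b
  proof
    assume "(a, b) \<in> quotient_graph G1 G2 x y"
    then obtain u c where c: "(a, u) \<in> ?S" "(c, b) \<in> L" "(c, u) \<in> ?S"
      unfolding mem_quotient_graph[OF x y(1)] y(2) by blast
    \<comment> \<open>Having the same value, \<open>a\<close> and \<open>c\<close> differ by an
      element of the kernel, hence of the fibre of \<open>L\<close> over the identity; multiplying
      by it carries \<open>(c, b)\<close> to \<open>(a, b)\<close> inside \<open>L\<close>.\<close>
    have "(a \<otimes>\<^bsub>G1\<^esub> inv\<^bsub>G1\<^esub> c, \<one>\<^bsub>U\<^esub>) \<in> ?S"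
      using partial_epi_unique_iff[OF assms(1,3) epi c(1,3)] by simp
    then show "(a, b) \<in> L"
      using DirProd_subgroup_fibre[OF assms(1,2,4) c(2)] DirProd_subgroupD(1)[OF assms(1,3) S c(1)] ker
      by simp
  next
    assume ab: "(a, b) \<in> L"
    then obtain u where "(a, u) \<in> ?S" using dom by blast
    then show "(a, b) \<in> quotient_graph G1 G2 x y"
      unfolding mem_quotient_graph[OF x y(1)] y(2) using ab by blast
  qed
  then have "quotient_graph G1 G2 x y = L" by auto
  then show ?thesis using that x y(1) by blast
qed

text \<open>The common value must be the identity, since graphs are single-valued and contain the
  pair of identities. Equal subgroups therefore come from morphisms with equal kernels, as
  \<open>morph_le_unique\<close> requires.\<close>

lemma quotient_graph_kernel:
  assumes "group G1" "group G2" "group U" "x \<in> U_morphisms G1 U" "y \<in> U_morphisms G2 U"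
  shows "(a, \<one>\<^bsub>G2\<^esub>) \<in> quotient_graph G1 G2 x y \<longleftrightarrow> (a, \<one>\<^bsub>U\<^esub>) \<in> morph_graph G1 x"
    "(\<one>\<^bsub>G1\<^esub>, b) \<in> quotient_graph G1 G2 x y \<longleftrightarrow> (b, \<one>\<^bsub>U\<^esub>) \<in> morph_graph G2 y"
proof -
  have "(\<one>\<^bsub>G1\<^esub>, u) \<in> morph_graph G1 x \<longleftrightarrow> u = \<one>\<^bsub>U\<^esub>" for u
    using partial_epi_morph_graph[OF assms(1,3,4)] DirProd_subgroupD(3)[OF assms(1,3)]
    by (meson partial_epi_def single_valuedD)
  moreover have "(\<one>\<^bsub>G2\<^esub>, u) \<in> morph_graph G2 y \<longleftrightarrow> u = \<one>\<^bsub>U\<^esub>" for u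
    using partial_epi_morph_graph[OF assms(2,3,5)] DirProd_subgroupD(3)[OF assms(2,3)]
    by (meson partial_epi_def single_valuedD)
  ultimately show
    "(a, \<one>\<^bsub>G2\<^esub>) \<in> quotient_graph G1 G2 x y \<longleftrightarrow> (a, \<one>\<^bsub>U\<^esub>) \<in> morph_graph G1 x"
    "(\<one>\<^bsub>G1\<^esub>, b) \<in> quotient_graph G1 G2 x y \<longleftrightarrow> (b, \<one>\<^bsub>U\<^esub>) \<in> morph_graph G2 y"
    unfolding mem_quotient_graph[OF assms(4,5)] by auto
qed

text \<open>Above a fixed \<open>y\<close>, a morphism is determined by its kernel: as
  \<open>y\<close> is onto \<open>U\<close>, it supplies a point of each fibre, and the fibre is the
  coset of the kernel through that point.\<close>

lemma morph_le_unique: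
  assumes "group G" "group U"
    and "x \<in> U_morphisms G U" "z \<in> U_morphisms G U" "y \<in> U_morphisms G U"
    and "morph_le G y x" "morph_le G y z"
    and "\<And>a. (a, \<one>\<^bsub>U\<^esub>) \<in> morph_graph G x \<longleftrightarrow> (a, \<one>\<^bsub>U\<^esub>) \<in> morph_graph G z"
  shows "x = z"
proof -
  have epi: "partial_epi G U (morph_graph G w)" if "w \<in> U_morphisms G U" for w
    by (rule partial_epi_morph_graph[OF assms(1,2) that])
  have *: "(p, u) \<in> morph_graph G w'"
    if w: "w \<in> U_morphisms G U" "w' \<in> U_morphisms G U" "morph_le G y w" "morph_le G y w'"
      and ker: "\<And>a. (a, \<one>\<^bsub>U\<^esub>) \<in> morph_graph G w \<longleftrightarrow> (a, \<one>\<^bsub>U\<^esub>) \<in> morph_graph G w'"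
      and pu: "(p, u) \<in> morph_graph G w" for w w' p u
  proof -
    have sub: "subgroup (morph_graph G w') (G \<times>\<times> U)"
      "subgroup (morph_graph G w) (G \<times>\<times> U)"
      using epi[OF w(2)] epi[OF w(1)] by (auto simp: partial_epi_def)
    have "u \<in> carrier U" using DirProd_subgroupD(2)[OF assms(1,2) sub(2) pu] .
    then obtain q where q: "(q, u) \<in> morph_graph G y"
      using epi[OF assms(5)] by (auto simp: partial_epi_def simp del: morph_graph.simps)
    then have "(q, u) \<in> morph_graph G w" "(q, u) \<in> morph_graph G w'"
      using w(3,4) by (auto simp: morph_le_def simp del: morph_graph.simps)
    then show ?thesis
      using DirProd_subgroup_fibre[OF assms(1,2) sub(1)] DirProd_subgroup_fibre[OF assms(1,2) sub(2)]
        DirProd_subgroupD(1)[OF assms(1,2) sub(2) pu] pu ker by blast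
  qed
  have "(p, u) \<in> morph_graph G x \<longleftrightarrow> (p, u) \<in> morph_graph G z" for p u
    using *[OF assms(3,4,6,7,8)] *[OF assms(4,3,7,6) assms(8)[symmetric]] by blast
  then have "morph_graph G x = morph_graph G z" by auto
  then show ?thesis using inj_onD[OF inj_on_morph_graph[OF assms(1,2)]] assms(3,4) by blast
qed

text \<open>Containment of graphs means that \<open>\<theta>\<close> and \<open>\<theta>'\<close>
  have the same values on \<open>P'\<close>, so the canonical map is \<open>\<theta>'\<close>
  followed by the inverse of \<open>\<theta>\<close>, a composite of isomorphisms.\<close>

lemma morph_le_canonical_iso:
  assumes "(P', K', \<theta>') \<in> U_morphisms G U" "(P, K, \<theta>) \<in> U_morphisms G U"
    and "morph_le G (P', K', \<theta>') (P, K, \<theta>)"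
  shows "canonical_iso G P' K' P K"
proof -
  let ?f = "inv_into (carrier (quot G P K)) \<theta> \<circ> \<theta>'"
  have sec: "is_section G P K" and iso: "\<theta> \<in> iso (quot G P K) U" "\<theta>' \<in> iso (quot G P' K') U"
    using assms(1,2) by (auto simp: U_morphisms_def)
  have "?f \<in> iso (quot G P' K') (quot G P K)"
    using iso_set_trans[OF iso(2) group.iso_set_sym[OF group_quot[OF sec] iso(1)]] .
  moreover have "?f (K' #>\<^bsub>G\<^esub> p) = K #>\<^bsub>G\<^esub> p" if "p \<in> P'" for p
  proof -
    have "(p, \<theta>' (K' #>\<^bsub>G\<^esub> p)) \<in> morph_graph G (P, K, \<theta>)"
      using assms(3) that by (auto simp: morph_le_def)
    then have "p \<in> P" "\<theta>' (K' #>\<^bsub>G\<^esub> p) = \<theta> (K #>\<^bsub>G\<^esub> p)"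
      by auto
    then show ?thesis
      using iso(1) by (simp add: iso_iff inv_into_f_f carrier_quot)
  qed
  ultimately show ?thesis unfolding canonical_iso_def by blast
qed

section \<open>Transfer of the order between subgroups and pairs of
  \<open>U\<close>-morphisms\<close>

lemma le_PK_quotient_graph:
  assumes "x' \<in> U_morphisms G1 U" "x \<in> U_morphisms G1 U" "morph_le G1 x' x"
    and "y' \<in> U_morphisms G2 U" "y \<in> U_morphisms G2 U" "morph_le G2 y' y"
  shows "le_PK G1 G2 (quotient_graph G1 G2 x' y') (quotient_graph G1 G2 x y)"
proof -
  obtain P' K' \<theta>' where x': "x' = (P', K', \<theta>')" by (cases x')
  obtain P K \<theta> where x: "x = (P, K, \<theta>)" by (cases x)
  obtain Q' L' \<psi>' where y': "y' = (Q', L', \<psi>')" by (cases y')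
  obtain Q L \<psi> where y: "y = (Q, L, \<psi>)" by (cases y)
  have "quotient_graph G1 G2 x' y' \<subseteq> quotient_graph G1 G2 x y"
    unfolding quotient_graph_eq_relcomp[OF assms(1,4)] quotient_graph_eq_relcomp[OF assms(2,5)]
    using assms(3,6) unfolding morph_le_def by (intro relcomp_mono) auto
  then show ?thesis
    unfolding le_PK_def
    using goursat_quotient_graph[of P' K' \<theta>' G1 U Q' L' \<psi>' G2]
      goursat_quotient_graph[of P K \<theta> G1 U Q L \<psi> G2]
      morph_le_canonical_iso[of P' K' \<theta>' G1 U P K \<theta>] morph_le_canonical_iso[of Q' L' \<psi>' G2 U Q L \<psi>]
      assms unfolding x x' y y' by blast
qed

text \<open>In \<open>partial_epi_relcomp\<close>, the domain condition comes from the inclusion of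
  sections and the kernel condition from injectivity of a canonical map, the one for
  \<open>G2\<close> serving the morphism \<open>x\<close> of \<open>G1\<close> and conversely.
  Surjectivity enters when \<open>L\<close> is recovered from \<open>x\<close> and
  \<open>y\<close>.\<close>

lemma le_PK_quotient_graphE:
  assumes "group G1" "group G2" "group U" "x' \<in> U_morphisms G1 U" "y' \<in> U_morphisms G2 U"
    and "subgroup L (G1 \<times>\<times> G2)" "le_PK G1 G2 (quotient_graph G1 G2 x' y') L"
  obtains x y where "x \<in> U_morphisms G1 U" "y \<in> U_morphisms G2 U" "quotient_graph G1 G2 x y = L"
    "morph_le G1 x' x" "morph_le G2 y' y"
proof -
  let ?L' = "quotient_graph G1 G2 x' y'" and ?S = "morph_graph G1 x'" and ?R = "morph_graph G2 y'"
  obtain P1' K1' P2' K2' P1 K1 P2 K2 where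
    sub: "?L' \<subseteq> L" and g': "goursat G1 G2 ?L' P1' K1' P2' K2'" and g: "goursat G1 G2 L P1 K1 P2 K2"
    and c1: "canonical_iso G1 P1' K1' P1 K1" and c2: "canonical_iso G2 P2' K2' P2 K2"
    using assms(7) by (auto simp: le_PK_def simp del: quotient_graph.simps)
  note g' = goursatD[OF assms(1,2) g'] and g = goursatD[OF assms(1,2) g]
  have sub1: "P1' \<subseteq> P1" and sub2: "P2' \<subseteq> P2" unfolding g(1,3) g'(1,3) using sub by auto
  note c1 = canonical_isoD[OF assms(1) g'(5) g(5) sub1 c1]
  note c2 = canonical_isoD[OF assms(2) g'(6) g(6) sub2 c2]
  note ker = quotient_graph_kernel[OF assms(1-5)]
  have epi1: "partial_epi G1 U ?S" and epi2: "partial_epi G2 U ?R"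
    using partial_epi_morph_graph assms(1-5) by blast+
  then have S: "subgroup ?S (G1 \<times>\<times> U)" "Range ?S = carrier U"
    and R: "subgroup ?R (G2 \<times>\<times> U)" "Range ?R = carrier U"
    by (simp_all add: partial_epi_def)
  note mem' = mem_quotient_graph[OF assms(4,5)]
  have RS: "\<exists>b. (b, u) \<in> ?R" if "(a, u) \<in> ?S" for a u
    using that R(2) S(2) by blast
  have SR: "\<exists>a. (a, u) \<in> ?S" if "(b, u) \<in> ?R" for b u
    using that R(2) S(2) by blast
  have dom1: "Domain ?S = P1'" unfolding g'(1) using RS mem' by blast
  have dom2: "Domain ?R = P2'" unfolding g'(3) using SR mem' by blast
  note L = DirProd_subgroupD[OF assms(1,2,6)]
  have "partial_epi G1 U (L O ?R)"
  proof (rule partial_epi_relcomp[OF assms(1-3,6) epi2])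
    show "Domain ?R \<subseteq> Range L" using dom2 sub2 g(3) by simp
    show "(b, \<one>\<^bsub>U\<^esub>) \<in> ?R" if "b \<in> Domain ?R" "(\<one>\<^bsub>G1\<^esub>, b) \<in> L" for b
      using that c2(1) dom2 ker(2) unfolding g(4) g'(4) by blast
  qed
  then obtain x where x: "x \<in> U_morphisms G1 U" "morph_graph G1 x = L O ?R"
    by (rule ex_U_morphism[OF assms(1,3)])
  have "partial_epi G2 U (L\<inverse> O ?S)"
  proof (rule partial_epi_relcomp[OF assms(2,1,3) subgroup_converse[OF assms(1,2,6)] epi1])
    show "Domain ?S \<subseteq> Range (L\<inverse>)" using dom1 sub1 g(1) by simp
    show "(a, \<one>\<^bsub>U\<^esub>) \<in> ?S" if "a \<in> Domain ?S" "(\<one>\<^bsub>G2\<^esub>, a) \<in> L\<inverse>" for a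
      using that c1(1) dom1 ker(1) unfolding g(2) g'(2) by blast
  qed
  then obtain y where y: "y \<in> U_morphisms G2 U" "morph_graph G2 y = L\<inverse> O ?S"
    by (rule ex_U_morphism[OF assms(2,3)])
  have "(p, u) \<in> L O ?R" if "(p, u) \<in> ?S" for p u
    using RS[OF that] mem' sub that by blast
  then have "morph_le G1 x' x" unfolding morph_le_def x(2) by auto
  moreover have "(q, u) \<in> L\<inverse> O ?S" if "(q, u) \<in> ?R" for q u
    using SR[OF that] mem' sub that by blast
  then have "morph_le G2 y' y" unfolding morph_le_def y(2) by auto
  moreover have "(a, b) \<in> quotient_graph G1 G2 x y \<longleftrightarrow> (a, b) \<in> L" for a b
  proof
    assume "(a, b) \<in> quotient_graph G1 G2 x y"
    then obtain u c d where cd: "(a, c) \<in> L" "(c, u) \<in> ?R" "(d, b) \<in> L" "(d, u) \<in> ?S"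
      unfolding mem_quotient_graph[OF x(1) y(1)] x(2) y(2) by blast
    \<comment> \<open>The elements \<open>d\<close> and \<open>c\<close> have the common value
      \<open>u\<close>, so they form a pair of the smaller subgroup. This pair links
      \<open>(a, c)\<close> to \<open>(d, b)\<close>: it puts the quotient of \<open>a\<close> and
      \<open>d\<close> into the fibre over the identity.\<close>
    have "(d, c) \<in> L" using cd(2,4) mem' sub by blast
    then have "(a \<otimes>\<^bsub>G1\<^esub> inv\<^bsub>G1\<^esub> d, \<one>\<^bsub>G2\<^esub>) \<in> L"
      using DirProd_subgroup_fibre[OF assms(1,2,6), of d c a] L(1) cd(1) by blast
    then show "(a, b) \<in> L"
      using DirProd_subgroup_fibre[OF assms(1,2,6) cd(3)] L(1)[OF cd(1)] by blast
  next
    assume ab: "(a, b) \<in> L"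
    \<comment> \<open>By \<open>P1 = K1 P1'\<close>, \<open>a\<close> is replaced by an element
      \<open>p\<close> on which \<open>x'\<close> is defined. The value \<open>u\<close> of
      \<open>p\<close> will be the common value witnessing that \<open>(a, b)\<close> is in the
      quotient graph.\<close>
    then obtain p where p: "p \<in> P1'" "(a \<otimes>\<^bsub>G1\<^esub> inv\<^bsub>G1\<^esub> p, \<one>\<^bsub>G2\<^esub>) \<in> L"
      using c1(2)[of a] unfolding g(1,2) by blast
    obtain u where u: "(p, u) \<in> ?S" using p(1) dom1 by blast
    obtain c where c: "(c, u) \<in> ?R" using RS u by blast
    have pc: "(p, c) \<in> L" using u c mem' sub by blast
    have aG: "a \<in> carrier G1" "p \<in> carrier G1" using L(1) ab pc by blast+
    have "(a, c) \<in> L" using DirProd_subgroup_fibre[OF assms(1,2,6) pc aG(1)] p(2) by simp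
    moreover have "(p, b) \<in> L"
    proof -
      interpret G1: group G1 by fact
      interpret G2: group G2 by fact
      show ?thesis
        \<comment> \<open>The product of the inverse of \<open>a p\<inverse>\<close> with
          \<open>a\<close> is \<open>p\<close>, while \<open>b\<close> is multiplied by the
          identity.\<close>
        using L(4)[OF L(5)[OF p(2)] ab] L(2)[OF ab] aG
        by (simp add: G1.inv_mult_group G1.m_assoc)
    qed
    ultimately show "(a, b) \<in> quotient_graph G1 G2 x y"
      unfolding mem_quotient_graph[OF x(1) y(1)] x(2) y(2) using u c by blast
  qed
  then have "quotient_graph G1 G2 x y = L" by auto
  ultimately show ?thesis using that x(1) y(1) by blast
qed

text \<open>The first components force \<open>\<alpha>\<close> to be the inverse of
  \<open>\<theta>\<close> followed by \<open>\<phi>\<close>. It also fits the second components,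
  because the common subgroup links every coset in \<open>Q\<close> to a coset in \<open>P\<close>
  with the same value. Allowing different targets serves both the comparison of blocks and the
  comparison within a block.\<close>

lemma quotient_graph_eqE:
  assumes "group G1" "group G2" "group U" "group V"
    and "x \<in> U_morphisms G1 U" "y \<in> U_morphisms G2 U" "z \<in> U_morphisms G1 V" "w \<in> U_morphisms G2 V"
    and "quotient_graph G1 G2 x y = quotient_graph G1 G2 z w"
  obtains \<alpha> where "\<alpha> \<in> iso U V" "\<alpha> \<in> extensional (carrier U)"
    "morph_aut G1 \<alpha> x = z" "morph_aut G2 \<alpha> y = w"
proof -
  obtain P K \<theta> where x: "x = (P, K, \<theta>)" by (cases x)
  obtain Q L \<psi> where y: "y = (Q, L, \<psi>)" by (cases y)
  obtain P' K' \<phi> where z: "z = (P', K', \<phi>)" by (cases z)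
  obtain Q' L' \<chi> where w: "w = (Q', L', \<chi>)" by (cases w)
  note g = goursatD[OF assms(1,2) goursat_quotient_graph[OF assms(5,6)[unfolded x y]]]
  note g' = goursatD[OF assms(1,2) goursat_quotient_graph[OF assms(7,8)[unfolded z w]]]
  note eq = assms(9)[unfolded x y z w]
  have same: "P' = P" "K' = K" "Q' = Q" "L' = L"
    using g(1-4) g'(1-4) eq by metis+
  have iso: "\<theta> \<in> iso (quot G1 P K) U" "\<psi> \<in> iso (quot G2 Q L) U"
    "\<phi> \<in> iso (quot G1 P K) V" "\<chi> \<in> iso (quot G2 Q L) V"
    and ext: "\<phi> \<in> extensional (carrier (quot G1 P K))" "\<chi> \<in> extensional (carrier (quot G2 Q L))"
    using assms(5-8) by (auto simp: U_morphisms_def x y z w same)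
  define \<alpha> where "\<alpha> = restrict (\<phi> \<circ> inv_into (carrier (quot G1 P K)) \<theta>) (carrier U)"
  have "\<phi> \<circ> inv_into (carrier (quot G1 P K)) \<theta> \<in> iso U V"
    using iso_set_trans[OF group.iso_set_sym[OF group_quot[OF g(5)] iso(1)] iso(3)] .
  then have \<alpha>: "\<alpha> \<in> iso U V"
    by (rule group.iso_eq[OF assms(3)]) (simp add: \<alpha>_def)
  have \<alpha>\<theta>: "\<alpha> (\<theta> X) = \<phi> X" if "X \<in> carrier (quot G1 P K)" for X
    using iso(1) that by (auto simp: \<alpha>_def iso_iff)
  have \<alpha>\<psi>: "\<alpha> (\<psi> Y) = \<chi> Y" if Y: "Y \<in> carrier (quot G2 Q L)" for Y
  proof -
    obtain q where q: "q \<in> Q" "Y = L #>\<^bsub>G2\<^esub> q" using Y by (auto simp: carrier_quot)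
    then obtain p where pq: "(p, q) \<in> quotient_graph G1 G2 x y"
      using g(3) by (auto simp: x y simp del: quotient_graph.simps)
    have "p \<in> P" "\<theta> (K #>\<^bsub>G1\<^esub> p) = \<psi> Y"
      using pq unfolding mem_quotient_graph[OF assms(5,6)] by (auto simp: x y q)
    moreover have "\<phi> (K #>\<^bsub>G1\<^esub> p) = \<chi> Y"
      using pq unfolding assms(9) mem_quotient_graph[OF assms(7,8)] by (auto simp: z w q same)
    ultimately show ?thesis using \<alpha>\<theta>[of "K #>\<^bsub>G1\<^esub> p"] by (simp add: carrier_quot)
  qed
  have "compose (carrier (quot G1 P K)) \<alpha> \<theta> = \<phi>"
    using ext(1) \<alpha>\<theta> by (auto simp: compose_def extensional_def)
  moreover have "compose (carrier (quot G2 Q L)) \<alpha> \<psi> = \<chi>"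
    using ext(2) \<alpha>\<psi> by (auto simp: compose_def extensional_def)
  ultimately show ?thesis
    using that[OF \<alpha>] by (simp add: x y z w same) (simp add: \<alpha>_def)
qed

section \<open>Incidence matrices\<close>

text \<open>The representative in \<open>class_incidence\<close> is chosen by \<open>SOME\<close>;
  an element that carries \<open>w\<close> to it maps the members of the orbit above
  \<open>w\<close> bijectively to those above the chosen one.\<close>

lemma (in right_action) class_incidence_orbit:
  assumes "x \<in> E" "y \<in> E" "w \<in> orbit G \<phi> y"
    and mono: "\<And>a u v. a \<in> carrier G \<Longrightarrow> u \<in> E \<Longrightarrow> v \<in> E \<Longrightarrow> leq u v \<Longrightarrow> leq (\<phi> a u) (\<phi> a v)"
  shows "class_incidence leq (orbit G \<phi> x) (orbit G \<phi> y) = int (card {z \<in> orbit G \<phi> x. leq w z})"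
proof -
  define w' where "w' = (SOME z. z \<in> orbit G \<phi> y)"
  have w': "w' \<in> orbit G \<phi> y" unfolding w'_def using assms(3) by (rule someI)
  have "w \<in> E" "w' \<in> E" using assms(2,3) w' orbit_subset by blast+
  have orb: "\<phi> a z \<in> orbit G \<phi> x" if "a \<in> carrier G" "z \<in> orbit G \<phi> x" for a z
    using that assms(1) by (auto simp: orbit_def act_mult)
  obtain a where a: "a \<in> carrier G" "w' = \<phi> a w"
    using w' orbit_eq_iff[OF assms(2) \<open>w \<in> E\<close>] assms(3) by (auto simp: orbit_def)
  have xE: "z \<in> E" if "z \<in> orbit G \<phi> x" for z using that orbit_subset[OF assms(1)] by blast
  have "bij_betw (\<phi> a) {z \<in> orbit G \<phi> x. leq w z} {z \<in> orbit G \<phi> x. leq w' z}"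
  proof (rule bij_betw_byWitness[where f' = "\<phi> (inv a)"])
    show "\<forall>z\<in>{z \<in> orbit G \<phi> x. leq w z}. \<phi> (inv a) (\<phi> a z) = z"
      using act_inv[OF a(1)] xE by blast
    show "\<forall>z\<in>{z \<in> orbit G \<phi> x. leq w' z}. \<phi> a (\<phi> (inv a) z) = z"
      using act_inv[of "inv a"] a(1) xE by simp
    show "\<phi> a ` {z \<in> orbit G \<phi> x. leq w z} \<subseteq> {z \<in> orbit G \<phi> x. leq w' z}"
      using mono[OF a(1) \<open>w \<in> E\<close>] orb[OF a(1)] xE a(2) by blast
    have "\<phi> (inv a) w' = w" using act_inv a \<open>w \<in> E\<close> by simp
    then show "\<phi> (inv a) ` {z \<in> orbit G \<phi> x. leq w' z} \<subseteq> {z \<in> orbit G \<phi> x. leq w z}"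
      using mono[OF inv_closed[OF a(1)] \<open>w' \<in> E\<close>] orb[OF inv_closed[OF a(1)]] xE by fastforce
  qed
  then show ?thesis
    by (simp add: class_incidence_def bij_betw_same_card flip: w'_def)
qed

section \<open>Classes of \<open>U\<close>-morphisms and classes of subgroups\<close>

lemma morph_le_conj:
  assumes "group G" "group U" "x \<in> U_morphisms G U" "y \<in> U_morphisms G U" "a \<in> carrier G"
    and "morph_le G x y"
  shows "morph_le G (morph_conj G a x) (morph_conj G a y)"
  using assms(6) unfolding morph_le_def morph_conj_graph(2)[OF assms(1,2,3,5)]
    morph_conj_graph(2)[OF assms(1,2,4,5)] graph_conj_def by (rule image_mono)

lemma class_incidence_morph_class:
  assumes "group G" "group U" "x \<in> U_morphisms G U" "y \<in> U_morphisms G U" "w \<in> morph_class G y"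
  shows "class_incidence (morph_le G) (morph_class G x) (morph_class G y) =
    int (card {z \<in> morph_class G x. morph_le G w z})"
  using right_action.class_incidence_orbit[OF right_action_morph_conj[OF assms(1,2)] assms(3-5)]
    morph_le_conj[OF assms(1,2)] by blast

lemma morph_classesE:
  assumes "C \<in> morph_classes G U"
  obtains x where "x \<in> U_morphisms G U" "C = morph_class G x"
  using assms by (auto simp: morph_classes_def orbits_def)

text \<open>Conjugating the two morphisms independently, by \<open>a\<close> and \<open>b\<close>,
  is conjugation of the subgroup by \<open>(a, b)\<close>. This makes the label of a pair of classes
  well defined.\<close>

lemma orbit_quotient_graph_conj:
  assumes "group G1" "group G2" "group U" "x \<in> U_morphisms G1 U" "y \<in> U_morphisms G2 U"
    and "z \<in> morph_class G1 x" "w \<in> morph_class G2 y"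
  shows "orbit (G1 \<times>\<times> G2) (conj_set (G1 \<times>\<times> G2)) (quotient_graph G1 G2 z w) =
    orbit (G1 \<times>\<times> G2) (conj_set (G1 \<times>\<times> G2)) (quotient_graph G1 G2 x y)"
proof -
  obtain a b where ab: "a \<in> carrier G1" "b \<in> carrier G2" "z = morph_conj G1 a x" "w = morph_conj G2 b y"
    using assms(6,7) by (auto simp: orbit_def)
  show ?thesis
    using right_action.orbit_act[OF group.right_action_conj_set[OF DirProd_group[OF assms(1,2)]],
        of "quotient_graph G1 G2 x y" "(a, b)"] subgroup_quotient_graph[OF assms(1-5)]
      quotient_graph_conj[OF assms(1-5) ab(1,2)] ab by simp
qed

text \<open>This separates the blocks: non-isomorphic representatives cannot produce conjugate
  subgroups.\<close>

lemma orbit_quotient_graph_iso: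
  fixes U :: "('u, 'k) monoid_scheme" and V :: "('u, 'l) monoid_scheme"
  assumes "group G1" "group G2" "group U" "group V"
    and "x \<in> U_morphisms G1 U" "y \<in> U_morphisms G2 U" "z \<in> U_morphisms G1 V" "w \<in> U_morphisms G2 V"
    and "quotient_graph G1 G2 z w \<in>
      orbit (G1 \<times>\<times> G2) (conj_set (G1 \<times>\<times> G2)) (quotient_graph G1 G2 x y)"
  shows "U \<cong> V"
proof -
  obtain a b where ab: "a \<in> carrier G1" "b \<in> carrier G2"
    "quotient_graph G1 G2 z w = conj_set (G1 \<times>\<times> G2) (a, b) (quotient_graph G1 G2 x y)"
    using assms(9) by (auto simp: orbit_def)
  have "quotient_graph G1 G2 (morph_conj G1 a x) (morph_conj G2 b y) = quotient_graph G1 G2 z w"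
    using quotient_graph_conj[OF assms(1-3,5,6) ab(1,2)] ab(3) by simp
  from quotient_graph_eqE[OF assms(1-4) morph_conj_graph(1)[OF assms(1,3,5) ab(1)]
      morph_conj_graph(1)[OF assms(2,3,6) ab(2)] assms(7,8) this]
  show ?thesis by (metis is_isoI)
qed

text \<open>Once \<open>x\<close> and \<open>y\<close> are conjugated so that the subgroups are
  equal, \<open>quotient_graph_eqE\<close> leaves only an automorphism of \<open>U\<close>, and it
  commutes with the conjugations. This is the bijectivity of the labelling inside one block.\<close>

lemma orbit_quotient_graph_iff:
  assumes "group G1" "group G2" "group U"
    and "x \<in> U_morphisms G1 U" "y \<in> U_morphisms G2 U" "z \<in> U_morphisms G1 U" "w \<in> U_morphisms G2 U"
  shows "quotient_graph G1 G2 z w \<in>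
      orbit (G1 \<times>\<times> G2) (conj_set (G1 \<times>\<times> G2)) (quotient_graph G1 G2 x y) \<longleftrightarrow>
    (morph_class G1 z, morph_class G2 w) \<in>
      orbit (Out U) (diag_action (out_class G1) (out_class G2)) (morph_class G1 x, morph_class G2 y)"
    (is "?L \<longleftrightarrow> ?R")
proof -
  interpret A1: right_action G1 "U_morphisms G1 U" "morph_conj G1"
    by (rule right_action_morph_conj[OF assms(1,3)])
  interpret A2: right_action G2 "U_morphisms G2 U" "morph_conj G2"
    by (rule right_action_morph_conj[OF assms(2,3)])
  interpret A: right_action "G1 \<times>\<times> G2" "{L. subgroup L (G1 \<times>\<times> G2)}" "conj_set (G1 \<times>\<times> G2)"
    by (rule group.right_action_conj_set[OF DirProd_group[OF assms(1,2)]])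
  note sub = subgroup_quotient_graph[OF assms(1-3)]
  show ?thesis
  proof
    assume ?L
    then obtain a b where ab: "a \<in> carrier G1" "b \<in> carrier G2"
      "quotient_graph G1 G2 z w = conj_set (G1 \<times>\<times> G2) (a, b) (quotient_graph G1 G2 x y)"
      by (auto simp: orbit_def)
    have eq: "quotient_graph G1 G2 (morph_conj G1 a x) (morph_conj G2 b y) = quotient_graph G1 G2 z w"
      using quotient_graph_conj[OF assms(1-5) ab(1,2)] ab(3) by simp
    obtain \<alpha> where \<alpha>: "\<alpha> \<in> iso U U" "\<alpha> \<in> extensional (carrier U)"
      "morph_aut G1 \<alpha> (morph_conj G1 a x) = z" "morph_aut G2 \<alpha> (morph_conj G2 b y) = w"
      using quotient_graph_eqE[OF assms(1-3,3) A1.closed[OF ab(1) assms(4)]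
          A2.closed[OF ab(2) assms(5)] assms(6,7) eq] by metis
    have "z = morph_conj G1 a (morph_aut G1 \<alpha> x)" "w = morph_conj G2 b (morph_aut G2 \<alpha> y)"
      using morph_conj_aut[OF assms(1,3,3,4) \<alpha>(1) ab(1)] morph_conj_aut[OF assms(2,3,3,5) \<alpha>(1) ab(2)]
        \<alpha>(3,4) by simp_all
    then have "morph_class G1 z = morph_class G1 (morph_aut G1 \<alpha> x)"
      "morph_class G2 w = morph_class G2 (morph_aut G2 \<alpha> y)"
      using A1.orbit_act A2.orbit_act ab morph_aut_U_morphisms \<alpha>(1) assms(4,5) by metis+
    then show ?R
      unfolding Out_orbit[OF assms(1-5)] using \<alpha>(1,2) by (auto simp: mem_auto_iff)
  next
    assume ?R
    then obtain \<alpha> where \<alpha>: "\<alpha> \<in> iso U U" "morph_class G1 z = morph_class G1 (morph_aut G1 \<alpha> x)"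
      "morph_class G2 w = morph_class G2 (morph_aut G2 \<alpha> y)"
      unfolding Out_orbit[OF assms(1-5)] by (auto simp: mem_auto_iff)
    note x\<alpha> = morph_aut_U_morphisms[OF assms(4) \<alpha>(1)] and y\<alpha> = morph_aut_U_morphisms[OF assms(5) \<alpha>(1)]
    have "z \<in> morph_class G1 (morph_aut G1 \<alpha> x)" "w \<in> morph_class G2 (morph_aut G2 \<alpha> y)"
      using A1.orbit_self[OF assms(6)] A2.orbit_self[OF assms(7)] \<alpha>(2,3) by simp_all
    from orbit_quotient_graph_conj[OF assms(1-3) x\<alpha> y\<alpha> this]
    show ?L
      using A.orbit_self[of "quotient_graph G1 G2 z w"] sub[OF assms(6,7)]
        quotient_graph_aut[OF assms(1-5) \<alpha>(1)] by simp
  qed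
qed

text \<open>The pairs \<open>(z, w)\<close> of \<open>U\<close>-morphisms above \<open>(u, v)\<close> correspond to the subgroups above the graph
  of \<open>u v\<inverse>\<close>, and the class of such a subgroup is decided by the \<open>Out(U)\<close>-orbit of \<open>([z], [w])\<close>.\<close>

lemma card_le_PK:
  assumes "group G1" "group G2" "group U" "finite (carrier G1)" "finite (carrier G2)"
    and "x \<in> U_morphisms G1 U" "y \<in> U_morphisms G2 U" "u \<in> U_morphisms G1 U" "v \<in> U_morphisms G2 U"
  shows "card {L \<in> orbit (G1 \<times>\<times> G2) (conj_set (G1 \<times>\<times> G2)) (quotient_graph G1 G2 x y).
      le_PK G1 G2 (quotient_graph G1 G2 u v) L} =
    (\<Sum>(C, D) \<in> orbit (Out U) (diag_action (out_class G1) (out_class G2))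
        (morph_class G1 x, morph_class G2 y).
      card {z \<in> C. morph_le G1 u z} * card {w \<in> D. morph_le G2 v w})"
proof -
  interpret A1: right_action G1 "U_morphisms G1 U" "morph_conj G1"
    by (rule right_action_morph_conj[OF assms(1,3)])
  interpret A2: right_action G2 "U_morphisms G2 U" "morph_conj G2"
    by (rule right_action_morph_conj[OF assms(2,3)])
  interpret A: right_action "G1 \<times>\<times> G2" "{L. subgroup L (G1 \<times>\<times> G2)}" "conj_set (G1 \<times>\<times> G2)"
    by (rule group.right_action_conj_set[OF DirProd_group[OF assms(1,2)]])
  let ?O = "orbit (Out U) (diag_action (out_class G1) (out_class G2))
        (morph_class G1 x, morph_class G2 y)"
  \<comment> \<open>For a pair of classes this is the set of its pairs of morphisms above
    \<open>u\<close> and \<open>v\<close>; its size is a product of two matrix entries.\<close>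
  let ?F = "\<lambda>(C, D). {z \<in> C. morph_le G1 u z} \<times> {w \<in> D. morph_le G2 v w}"
  let ?X = "{L \<in> orbit (G1 \<times>\<times> G2) (conj_set (G1 \<times>\<times> G2)) (quotient_graph G1 G2 x y).
      le_PK G1 G2 (quotient_graph G1 G2 u v) L}"
  have O: "\<exists>z\<in>U_morphisms G1 U. \<exists>w\<in>U_morphisms G2 U. C = morph_class G1 z \<and> D = morph_class G2 w"
    if "(C, D) \<in> ?O" for C D
  proof -
    from that obtain \<alpha> where "\<alpha> \<in> iso U U"
      "C = morph_class G1 (morph_aut G1 \<alpha> x)" "D = morph_class G2 (morph_aut G2 \<alpha> y)"
      unfolding Out_orbit[OF assms(1-3,6,7)] using mem_auto_iff[of _ U] by blast
    then show ?thesis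
      using morph_aut_U_morphisms[OF assms(6)] morph_aut_U_morphisms[OF assms(7)] by blast
  qed
  have cls: "C = morph_class G1 z \<and> D = morph_class G2 w \<and> z \<in> U_morphisms G1 U \<and> w \<in> U_morphisms G2 U"
    if CD: "(C, D) \<in> ?O" "z \<in> C" "w \<in> D" for C D z w
  proof -
    obtain z' w' where z': "z' \<in> U_morphisms G1 U" "w' \<in> U_morphisms G2 U"
      "C = morph_class G1 z'" "D = morph_class G2 w'"
      using O[OF CD(1)] by blast
    then have "z \<in> U_morphisms G1 U" "w \<in> U_morphisms G2 U"
      using CD(2,3) A1.orbit_subset[OF z'(1)] A2.orbit_subset[OF z'(2)] by blast+
    then show ?thesis
      using CD(2,3) A1.orbit_eq_iff[OF z'(1)] A2.orbit_eq_iff[OF z'(2)] z'(3,4) by metis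
  qed
  have mem: "(z, w) \<in> (\<Union>k\<in>?O. ?F k) \<longleftrightarrow> z \<in> U_morphisms G1 U \<and> w \<in> U_morphisms G2 U \<and>
    (morph_class G1 z, morph_class G2 w) \<in> ?O \<and> morph_le G1 u z \<and> morph_le G2 v w" for z w
  proof
    assume "(z, w) \<in> (\<Union>k\<in>?O. ?F k)"
    then obtain C D where "(C, D) \<in> ?O" "z \<in> C" "w \<in> D" "morph_le G1 u z" "morph_le G2 v w"
      by auto
    then show "z \<in> U_morphisms G1 U \<and> w \<in> U_morphisms G2 U \<and>
      (morph_class G1 z, morph_class G2 w) \<in> ?O \<and> morph_le G1 u z \<and> morph_le G2 v w"
      using cls by metis
  next
    assume "z \<in> U_morphisms G1 U \<and> w \<in> U_morphisms G2 U \<and>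
      (morph_class G1 z, morph_class G2 w) \<in> ?O \<and> morph_le G1 u z \<and> morph_le G2 v w"
    then show "(z, w) \<in> (\<Union>k\<in>?O. ?F k)"
      using A1.orbit_self[of z] A2.orbit_self[of w]
      by (intro UN_I[of "(morph_class G1 z, morph_class G2 w)"]) auto
  qed
  have "bij_betw (\<lambda>(z, w). quotient_graph G1 G2 z w) (\<Union>k\<in>?O. ?F k) ?X"
  proof (rule bij_betw_imageI)
    show "inj_on (\<lambda>(z, w). quotient_graph G1 G2 z w) (\<Union>k\<in>?O. ?F k)"
    proof (rule inj_onI)
      fix p q assume p: "p \<in> (\<Union>k\<in>?O. ?F k)" and q: "q \<in> (\<Union>k\<in>?O. ?F k)"
        and eq: "(\<lambda>(z, w). quotient_graph G1 G2 z w) p = (\<lambda>(z, w). quotient_graph G1 G2 z w) q"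
      obtain z w z' w' where zw: "p = (z, w)" "q = (z', w')" by (cases p; cases q)
      have z: "z \<in> U_morphisms G1 U" "z' \<in> U_morphisms G1 U" "morph_le G1 u z" "morph_le G1 u z'"
        and w: "w \<in> U_morphisms G2 U" "w' \<in> U_morphisms G2 U" "morph_le G2 v w" "morph_le G2 v w'"
        using p q unfolding zw mem by auto
      have eq: "quotient_graph G1 G2 z w = quotient_graph G1 G2 z' w'"
        using eq unfolding zw by (simp del: quotient_graph.simps)
      note ker = quotient_graph_kernel[OF assms(1-3) z(1) w(1)]
        and ker' = quotient_graph_kernel[OF assms(1-3) z(2) w(2)]
      \<comment> \<open>Equal subgroups have the same fibres over the identities, so
        \<open>z\<close> and \<open>z'\<close> have the same kernel, and both lie above
        \<open>u\<close>.\<close>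
      have "z = z'"
        by (rule morph_le_unique[OF assms(1,3) z(1,2) assms(8) z(3,4)])
          (simp add: ker(1)[symmetric] ker'(1)[symmetric] eq del: quotient_graph.simps)
      moreover have "w = w'"
        by (rule morph_le_unique[OF assms(2,3) w(1,2) assms(9) w(3,4)])
          (simp add: ker(2)[symmetric] ker'(2)[symmetric] eq del: quotient_graph.simps)
      ultimately show "p = q" by (simp add: zw)
    qed
    show "(\<lambda>(z, w). quotient_graph G1 G2 z w) ` (\<Union>k\<in>?O. ?F k) = ?X"
    proof (intro equalityI subsetI)
      fix L assume "L \<in> (\<lambda>(z, w). quotient_graph G1 G2 z w) ` (\<Union>k\<in>?O. ?F k)"
      then obtain p where p: "p \<in> (\<Union>k\<in>?O. ?F k)"
        "L = (\<lambda>(z, w). quotient_graph G1 G2 z w) p" by (elim imageE)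
      obtain z w where "p = (z, w)" by (cases p)
      with p have "(z, w) \<in> (\<Union>k\<in>?O. ?F k)" and L: "L = quotient_graph G1 G2 z w"
        unfolding case_prod_conv by blast+
      then have zw: "z \<in> U_morphisms G1 U" "w \<in> U_morphisms G2 U"
        "(morph_class G1 z, morph_class G2 w) \<in> ?O" "morph_le G1 u z" "morph_le G2 v w"
        unfolding mem by blast+
      show "L \<in> ?X"
        unfolding L using orbit_quotient_graph_iff[OF assms(1-3,6,7) zw(1,2)] zw(3)
          le_PK_quotient_graph[OF assms(8) zw(1,4) assms(9) zw(2,5)] by simp
    next
      fix L assume L: "L \<in> ?X"
      then have sub: "subgroup L (G1 \<times>\<times> G2)"
        using A.orbit_subset[of "quotient_graph G1 G2 x y"]
          subgroup_quotient_graph[OF assms(1-3,6,7)] by blast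
      obtain z w where zw: "z \<in> U_morphisms G1 U" "w \<in> U_morphisms G2 U"
        "quotient_graph G1 G2 z w = L" "morph_le G1 u z" "morph_le G2 v w"
        using le_PK_quotient_graphE[OF assms(1-3,8,9) sub] L by blast
      then have "(z, w) \<in> (\<Union>k\<in>?O. ?F k)"
        unfolding mem using orbit_quotient_graph_iff[OF assms(1-3,6,7) zw(1,2)] L by blast
      then show "L \<in> (\<lambda>(z, w). quotient_graph G1 G2 z w) ` (\<Union>k\<in>?O. ?F k)"
        by (rule image_eqI[rotated]) (use zw(3) in \<open>simp only: case_prod_conv\<close>)
    qed
  qed
  then have "card ?X = card (\<Union>k\<in>?O. ?F k)" by (rule bij_betw_same_card[symmetric])
  also have "\<dots> = (\<Sum>k\<in>?O. card (?F k))"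
  proof (rule card_UN_disjoint)
    note fin = finite_U_morphisms[OF assms(1,3,4)] finite_U_morphisms[OF assms(2,3,5)]
    have "?O \<subseteq> morph_class G1 ` U_morphisms G1 U \<times> morph_class G2 ` U_morphisms G2 U"
    proof (rule subrelI)
      show "(C, D) \<in> morph_class G1 ` U_morphisms G1 U \<times> morph_class G2 ` U_morphisms G2 U"
        if "(C, D) \<in> ?O" for C D
        using O[OF that] by blast
    qed
    then show "finite ?O" using fin by (meson finite_SigmaI finite_imageI finite_subset)
    show "\<forall>k\<in>?O. finite (?F k)"
    proof
      fix k assume "k \<in> ?O"
      then have "finite (fst k)" "finite (snd k)"
        using O[of "fst k" "snd k"] A1.orbit_subset A2.orbit_subset fin
        by (metis finite_subset prod.collapse)+
      then show "finite (?F k)" by (simp add: case_prod_beta)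
    qed
    \<comment> \<open>A morphism determines its class, so a pair common to two of the products
      forces \<open>k = l\<close>.\<close>
    show "\<forall>k\<in>?O. \<forall>l\<in>?O. k \<noteq> l \<longrightarrow> ?F k \<inter> ?F l = {}"
    proof (intro ballI impI)
      fix k l assume kl: "k \<in> ?O" "l \<in> ?O" "k \<noteq> l"
      show "?F k \<inter> ?F l = {}"
      proof (rule equals0I)
        fix p assume "p \<in> ?F k \<inter> ?F l"
        then have "fst p \<in> fst k" "snd p \<in> snd k" "fst p \<in> fst l" "snd p \<in> snd l"
          by (auto simp: case_prod_beta)
        then have "fst k = fst l" "snd k = snd l"
          using cls[of "fst k" "snd k" "fst p" "snd p"] cls[of "fst l" "snd l" "fst p" "snd p"] kl
          by simp_all
        with kl(3) show False by (simp add: prod_eq_iff)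
      qed
    qed
  qed
  also have "\<dots> = (\<Sum>(C, D) \<in> ?O. card {z \<in> C. morph_le G1 u z} * card {w \<in> D. morph_le G2 v w})"
    by (rule sum.cong) (auto simp: card_cartesian_product)
  finally show ?thesis .
qed

text \<open>Multiplication by \<open>C\<close> selects column \<open>j\<close>, and row
  \<open>i\<close> of \<open>R\<close> is the indicator function of an orbit, so the triple product
  collapses to a sum over that orbit.\<close>

lemma orbit_tensor_eq:
  assumes "finite X" "finite Y" "j \<in> X \<times> Y" "orbit H (diag_action \<phi> \<psi>) i \<subseteq> X \<times> Y"
  shows "orbit_tensor H X \<phi> Y \<psi> A B i j = (\<Sum>k\<in>orbit H (diag_action \<phi> \<psi>) i. kronecker A B k j)"
proof -
  let ?O = "orbit H (diag_action \<phi> \<psi>) i"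
  have "orbit_tensor H X \<phi> Y \<psi> A B i j =
    (\<Sum>k\<in>X \<times> Y. (if k \<in> ?O then 1 else 0) * kronecker A B k j)"
    unfolding orbit_tensor_def mat_prod_def Let_def
    using assms(1-3) by (simp add: sum.delta if_distrib[of "\<lambda>z. _ * z"] cong: if_cong)
  also have "\<dots> = (\<Sum>k\<in>X \<times> Y. if k \<in> ?O then kronecker A B k j else 0)"
    by (intro sum.cong) auto
  also have "\<dots> = (\<Sum>k\<in>(X \<times> Y) \<inter> ?O. kronecker A B k j)"
    using assms(1,2) by (simp add: sum.inter_restrict)
  also have "(X \<times> Y) \<inter> ?O = ?O" using assms(4) by blast
  finally show ?thesis .
qed

text \<open>The column is labelled by the classes of \<open>u\<close> and \<open>v\<close>, while
  the count uses conjugates \<open>u'\<close> and \<open>v'\<close>. This freedom is there because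
  the representative of a class of subgroups is chosen by \<open>SOME\<close>.\<close>

lemma card_le_PK_orbit_tensor:
  assumes "group G1" "group G2" "group U" "finite (carrier G1)" "finite (carrier G2)"
    and "x \<in> U_morphisms G1 U" "y \<in> U_morphisms G2 U" "u \<in> U_morphisms G1 U" "v \<in> U_morphisms G2 U"
    and "u' \<in> morph_class G1 u" "v' \<in> morph_class G2 v"
  shows "int (card {L \<in> orbit (G1 \<times>\<times> G2) (conj_set (G1 \<times>\<times> G2)) (quotient_graph G1 G2 x y).
      le_PK G1 G2 (quotient_graph G1 G2 u' v') L}) =
    orbit_tensor (Out U) (morph_classes G1 U) (out_class G1) (morph_classes G2 U) (out_class G2)
      (class_incidence (morph_le G1)) (class_incidence (morph_le G2))
      (morph_class G1 x, morph_class G2 y) (morph_class G1 u, morph_class G2 v)"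
proof -
  interpret A1: right_action G1 "U_morphisms G1 U" "morph_conj G1"
    by (rule right_action_morph_conj[OF assms(1,3)])
  interpret A2: right_action G2 "U_morphisms G2 U" "morph_conj G2"
    by (rule right_action_morph_conj[OF assms(2,3)])
  let ?O = "orbit (Out U) (diag_action (out_class G1) (out_class G2))
        (morph_class G1 x, morph_class G2 y)"
  have classes2: "morph_classes G2 U = morph_class G2 ` U_morphisms G2 U"
    and classes1: "morph_classes G1 U = morph_class G1 ` U_morphisms G1 U"
    by (auto simp: morph_classes_def orbits_def)
  have O: "\<exists>z\<in>U_morphisms G1 U. \<exists>w\<in>U_morphisms G2 U. k = (morph_class G1 z, morph_class G2 w)"
    if "k \<in> ?O" for k
  proof -
    from that obtain \<alpha> where "\<alpha> \<in> iso U U"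
      "k = (morph_class G1 (morph_aut G1 \<alpha> x), morph_class G2 (morph_aut G2 \<alpha> y))"
      unfolding Out_orbit[OF assms(1-3,6,7)] using mem_auto_iff[of _ U] by blast
    then show ?thesis
      using morph_aut_U_morphisms[OF assms(6)] morph_aut_U_morphisms[OF assms(7)] by blast
  qed
  have uv': "u' \<in> U_morphisms G1 U" "v' \<in> U_morphisms G2 U"
    using assms(8-11) A1.orbit_subset A2.orbit_subset by blast+
  have "orbit_tensor (Out U) (morph_classes G1 U) (out_class G1) (morph_classes G2 U) (out_class G2)
      (class_incidence (morph_le G1)) (class_incidence (morph_le G2))
      (morph_class G1 x, morph_class G2 y) (morph_class G1 u, morph_class G2 v) =
    (\<Sum>k\<in>?O. kronecker (class_incidence (morph_le G1)) (class_incidence (morph_le G2)) k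
      (morph_class G1 u, morph_class G2 v))"
  proof (rule orbit_tensor_eq)
    show "finite (morph_classes G1 U)" "finite (morph_classes G2 U)"
      using finite_U_morphisms[OF assms(1,3,4)] finite_U_morphisms[OF assms(2,3,5)]
      by (simp_all add: classes1 classes2)
    show "?O \<subseteq> morph_classes G1 U \<times> morph_classes G2 U" using O by (auto simp: classes1 classes2)
    show "(morph_class G1 u, morph_class G2 v) \<in> morph_classes G1 U \<times> morph_classes G2 U"
      using assms(8,9) by (simp add: classes1 classes2)
  qed
  also have "\<dots> = (\<Sum>k\<in>?O. case k of (C, D) \<Rightarrow>
      int (card {z \<in> C. morph_le G1 u' z} * card {w \<in> D. morph_le G2 v' w}))"
  proof (rule sum.cong)
    fix k assume "k \<in> ?O"
    then obtain z w where "z \<in> U_morphisms G1 U" "w \<in> U_morphisms G2 U"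
      "k = (morph_class G1 z, morph_class G2 w)" using O by blast
    then show "kronecker (class_incidence (morph_le G1)) (class_incidence (morph_le G2)) k
        (morph_class G1 u, morph_class G2 v) = (case k of (C, D) \<Rightarrow>
      int (card {z \<in> C. morph_le G1 u' z} * card {w \<in> D. morph_le G2 v' w}))"
      using class_incidence_morph_class[OF assms(1,3) _ assms(8,10), of z]
        class_incidence_morph_class[OF assms(2,3) _ assms(9,11), of w]
      by (simp add: kronecker_def)
  qed simp
  finally show ?thesis
    unfolding card_le_PK[OF assms(1-7) uv'] by (simp add: case_prod_beta)
qed

section \<open>The labelling and the block decomposition\<close>

lemma subquotient_if_U_morphism:
  assumes "group G" "x \<in> U_morphisms G U"
  shows "U \<sqsubseteq> G"
proof -
  obtain P K \<theta> where x: "is_section G P K" "\<theta> \<in> iso (quot G P K) U"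
    using assms(2) by (auto simp: U_morphisms_def)
  then have "U \<cong> quot G P K" by (metis group.iso_sym group_quot is_isoI)
  with x(1) show ?thesis by (auto simp: subquotient_def)
qed

theorem theorem6p5:
  fixes G1 :: "('a, 'm) monoid_scheme" and G2 :: "('b, 'n) monoid_scheme"
    and Us :: "'u monoid set"
    and T :: "'u monoid \<Rightarrow> (('a, 'u) morph set \<times> ('b, 'u) morph set) set"
  assumes "group G1" and "finite (carrier G1)"
    and "group G2" and "finite (carrier G2)"
    and "common_subquotient_reps G1 G2 Us"
    and "\<And>U. U \<in> Us \<Longrightarrow>
           transversal (Out U) (morph_classes G1 U \<times> morph_classes G2 U)
             (diag_action (out_class G1) (out_class G2)) (T U)"
  shows "\<exists>label.
     bij_betw label (SIGMA U:Us. T U)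
       (orbits (G1 \<times>\<times> G2) {L. subgroup L (G1 \<times>\<times> G2)} (conj_set (G1 \<times>\<times> G2))) \<and>
     (\<forall>(U, C1, C2) \<in> (SIGMA U:Us. T U). \<forall>\<theta>1\<in>C1. \<forall>\<theta>2\<in>C2.
        label (U, C1, C2) =
          orbit (G1 \<times>\<times> G2) (conj_set (G1 \<times>\<times> G2)) (quotient_graph G1 G2 \<theta>1 \<theta>2)) \<and>
     (\<forall>i \<in> (SIGMA U:Us. T U). \<forall>j \<in> (SIGMA U:Us. T U).
        class_incidence (le_PK G1 G2) (label i) (label j) =
          direct_sum
            (\<lambda>U. orbit_tensor (Out U)
               (morph_classes G1 U) (out_class G1) (morph_classes G2 U) (out_class G2)
               (class_incidence (morph_le G1)) (class_incidence (morph_le G2))) i j)"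
proof -
  note G = assms(1,3)
  have Us: "group U" if "U \<in> Us" for U
    using assms(5) that by (auto simp: common_subquotient_reps_def)
  have Us_eq: "U = V" if "U \<in> Us" "V \<in> Us" "U \<cong> V" for U V
    using assms(5) that by (auto simp: common_subquotient_reps_def)
  let ?\<G> = "G1 \<times>\<times> G2"
  let ?orb = "orbit ?\<G> (conj_set ?\<G>)"
  let ?out = "\<lambda>U. orbit (Out U) (diag_action (out_class G1) (out_class G2))"
  interpret A: right_action ?\<G> "{L. subgroup L ?\<G>}" "conj_set ?\<G>"
    by (rule group.right_action_conj_set[OF DirProd_group[OF G]])
  have self: "x \<in> morph_class G x" if "group G" "group U" "x \<in> U_morphisms G U"
    for G :: "('c, 'k) monoid_scheme" and U :: "'u monoid" and x
    by (rule right_action.orbit_self[OF right_action_morph_conj[OF that(1,2)] that(3)])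
  \<comment> \<open>The choice of representatives is harmless by
    \<open>orbit_quotient_graph_conj\<close>; the fact \<open>label\<close> below evaluates the
    function at any of them.\<close>
  define label where "label = (\<lambda>(U :: 'u monoid, C1 :: ('a, 'u) morph set, C2 :: ('b, 'u) morph set).
    ?orb (quotient_graph G1 G2 (SOME x. x \<in> C1) (SOME y. y \<in> C2)))"
  have elem: "\<exists>x y. U \<in> Us \<and> x \<in> U_morphisms G1 U \<and> y \<in> U_morphisms G2 U \<and>
      C1 = morph_class G1 x \<and> C2 = morph_class G2 y"
    if "(U, C1, C2) \<in> Sigma Us T" for U C1 C2
  proof -
    have U: "U \<in> Us" and "(C1, C2) \<in> T U" using that by auto
    then have "C1 \<in> morph_classes G1 U" "C2 \<in> morph_classes G2 U"
      using assms(6)[OF U] by (auto simp: transversal_def)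
    then show ?thesis using U by (metis morph_classesE)
  qed
  have label: "label (U, morph_class G1 x, morph_class G2 y) = ?orb (quotient_graph G1 G2 x y)"
    if "group U" "x \<in> U_morphisms G1 U" "y \<in> U_morphisms G2 U" for U x y
  proof -
    have "(SOME z. z \<in> morph_class G1 x) \<in> morph_class G1 x"
      "(SOME z. z \<in> morph_class G2 y) \<in> morph_class G2 y"
      using self[OF G(1) that(1,2)] self[OF G(2) that(1,3)] by (meson someI)+
    from orbit_quotient_graph_conj[OF G that this] show ?thesis by (simp add: label_def)
  qed
  note sub = subgroup_quotient_graph[OF G]
  have "inj_on label (Sigma Us T)"
  proof (rule inj_onI)
    fix i j assume i: "i \<in> Sigma Us T" and j: "j \<in> Sigma Us T" and eq: "label i = label j"
    obtain U C1 C2 where i': "i = (U, C1, C2)" by (cases i)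
    obtain V D1 D2 where j': "j = (V, D1, D2)" by (cases j)
    obtain x y where x: "U \<in> Us" "x \<in> U_morphisms G1 U" "y \<in> U_morphisms G2 U"
      "C1 = morph_class G1 x" "C2 = morph_class G2 y" using elem i i' by blast
    obtain z w where z: "V \<in> Us" "z \<in> U_morphisms G1 V" "w \<in> U_morphisms G2 V"
      "D1 = morph_class G1 z" "D2 = morph_class G2 w" using elem j j' by blast
    have mem: "quotient_graph G1 G2 z w \<in> ?orb (quotient_graph G1 G2 x y)"
      using eq label[OF Us x(2,3)] label[OF Us z(2,3)] x z A.orbit_self sub[OF Us z(2,3)]
      by (simp add: i' j')
    have UV: "U = V"
      using Us_eq[OF x(1) z(1)] orbit_quotient_graph_iso[OF G Us[OF x(1)] Us[OF z(1)] x(2,3) z(2,3) mem]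
      by blast
    note z = z[folded UV]
    have "(D1, D2) \<in> ?out U (C1, C2)"
      using mem orbit_quotient_graph_iff[OF G Us[OF x(1)] x(2,3) z(2,3)] x z by simp
    \<comment> \<open>That the pair lies in its own orbit is read off from the side of subgroups, by
      comparing a subgroup with itself in \<open>orbit_quotient_graph_iff\<close>.\<close>
    moreover have "(C1, C2) \<in> ?out U (C1, C2)"
      using A.orbit_self[of "quotient_graph G1 G2 x y"] sub[OF Us[OF x(1)] x(2,3)]
        orbit_quotient_graph_iff[OF G Us[OF x(1)] x(2,3) x(2,3)] x by simp
    moreover have "(C1, C2) \<in> T U" "(D1, D2) \<in> T U" using i j i' j' UV by auto
    moreover have "?out U (C1, C2) \<in> orbits (Out U) (morph_classes G1 U \<times> morph_classes G2 U)
        (diag_action (out_class G1) (out_class G2))"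
      using assms(6)[OF x(1)] \<open>(C1, C2) \<in> T U\<close> by (auto simp: transversal_def orbits_def)
    ultimately have "(C1, C2) = (D1, D2)"
      using assms(6)[OF x(1)] unfolding transversal_def by (metis IntI)
    then show "i = j" by (simp add: i' j' UV)
  qed
  moreover have "label ` Sigma Us T = orbits ?\<G> {L. subgroup L ?\<G>} (conj_set ?\<G>)"
  proof (intro equalityI subsetI)
    fix X assume "X \<in> label ` Sigma Us T"
    then obtain U C1 C2 where X: "(U, C1, C2) \<in> Sigma Us T" "X = label (U, C1, C2)" by auto
    then obtain x y where x: "U \<in> Us" "x \<in> U_morphisms G1 U" "y \<in> U_morphisms G2 U"
      "C1 = morph_class G1 x" "C2 = morph_class G2 y" using elem by blast
    have "X = ?orb (quotient_graph G1 G2 x y)"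
      unfolding X(2) x(4,5) by (rule label[OF Us[OF x(1)] x(2,3)])
    then show "X \<in> orbits ?\<G> {L. subgroup L ?\<G>} (conj_set ?\<G>)"
      unfolding orbits_def using sub[OF Us[OF x(1)] x(2,3)] by blast
  next
    fix X assume "X \<in> orbits ?\<G> {L. subgroup L ?\<G>} (conj_set ?\<G>)"
    then obtain L where L: "subgroup L ?\<G>" "X = ?orb L" by (auto simp: orbits_def)
    let ?Q = "quot G1 (Domain L) {a. (a, \<one>\<^bsub>G2\<^esub>) \<in> L}"
    note sec = subgroup_section[OF G L(1)]
    \<comment> \<open>With \<open>?Q\<close> itself as target group, \<open>L\<close> yields a
      morphism from a section of \<open>G2\<close> onto \<open>?Q\<close>.\<close>
    have "?Q \<sqsubseteq> G2"
      using ex_quotient_graph[OF G group_quot[OF sec] L(1) iso_refl] subquotient_if_U_morphism[OF G(2)]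
      by metis
    then obtain U where U: "U \<in> Us" "?Q \<cong> U"
      using assms(5) sec unfolding common_subquotient_reps_def by blast
    obtain x y where x: "x \<in> U_morphisms G1 U" "y \<in> U_morphisms G2 U" "quotient_graph G1 G2 x y = L"
      using ex_quotient_graph[OF G Us[OF U(1)] L(1) U(2)] by metis
    let ?c = "(morph_class G1 x, morph_class G2 y)"
    have "?out U ?c \<in> orbits (Out U) (morph_classes G1 U \<times> morph_classes G2 U)
        (diag_action (out_class G1) (out_class G2))"
      using x(1,2) unfolding morph_classes_def orbits_def by blast
    \<comment> \<open>The pair found for \<open>L\<close> need not lie in \<open>T U\<close>, but
      its orbit meets \<open>T U\<close>, and the pair found there gives a conjugate of
      \<open>L\<close>.\<close>
    then obtain C1 C2 where C: "(C1, C2) \<in> T U" "(C1, C2) \<in> ?out U ?c"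
      using assms(6)[OF U(1)] unfolding transversal_def by (metis IntE surj_pair)
    then obtain z w where z: "z \<in> U_morphisms G1 U" "w \<in> U_morphisms G2 U"
      "C1 = morph_class G1 z" "C2 = morph_class G2 w" using elem[of U C1 C2] U(1) by auto
    have "quotient_graph G1 G2 z w \<in> ?orb L"
      using C(2) orbit_quotient_graph_iff[OF G Us[OF U(1)] x(1,2) z(1,2)] x(3) z(3,4) by simp
    then have "X = label (U, C1, C2)"
      using A.orbit_eq_iff[of L "quotient_graph G1 G2 z w"] L sub[OF Us[OF U(1)] z(1,2)]
        label[OF Us[OF U(1)] z(1,2)] z(3,4) by simp
    then show "X \<in> label ` Sigma Us T" using C(1) U(1) by blast
  qed
  ultimately have bij: "bij_betw label (Sigma Us T) (orbits ?\<G> {L. subgroup L ?\<G>} (conj_set ?\<G>))"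
    by (rule bij_betw_imageI)
  have rep: "label (U, C1, C2) = ?orb (quotient_graph G1 G2 \<theta>1 \<theta>2)"
    if "(U, C1, C2) \<in> Sigma Us T" "\<theta>1 \<in> C1" "\<theta>2 \<in> C2" for U C1 C2 \<theta>1 \<theta>2
    using elem[OF that(1)] that(2,3) label Us orbit_quotient_graph_conj[OF G] by metis
  have inc: "class_incidence (le_PK G1 G2) (label i) (label j) =
      direct_sum (\<lambda>U. orbit_tensor (Out U)
         (morph_classes G1 U) (out_class G1) (morph_classes G2 U) (out_class G2)
         (class_incidence (morph_le G1)) (class_incidence (morph_le G2))) i j"
    if i: "i \<in> Sigma Us T" and j: "j \<in> Sigma Us T" for i j
  proof -
    obtain U C1 C2 where i': "i = (U, C1, C2)" by (cases i)
    obtain V D1 D2 where j': "j = (V, D1, D2)" by (cases j)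
    obtain x y where x: "U \<in> Us" "x \<in> U_morphisms G1 U" "y \<in> U_morphisms G2 U"
      "C1 = morph_class G1 x" "C2 = morph_class G2 y" using elem i i' by blast
    obtain z w where z: "V \<in> Us" "z \<in> U_morphisms G1 V" "w \<in> U_morphisms G2 V"
      "D1 = morph_class G1 z" "D2 = morph_class G2 w" using elem j j' by blast
    note UG = Us[OF x(1)] and VG = Us[OF z(1)]
    have li: "label i = ?orb (quotient_graph G1 G2 x y)" using label[OF UG x(2,3)] by (simp add: i' x)
    have lj: "label j = ?orb (quotient_graph G1 G2 z w)" using label[OF VG z(2,3)] by (simp add: j' z)
    \<comment> \<open>This is the representative used by \<open>class_incidence\<close>. As a
      conjugate of the graph built from \<open>z\<close> and \<open>w\<close>, it is the graph built
      from conjugates of them.\<close>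
    define L' where "L' = (SOME L. L \<in> label j)"
    have "L' \<in> label j"
      unfolding L'_def lj using A.orbit_self sub[OF VG z(2,3)] by (metis CollectI someI)
    then obtain a b where ab: "a \<in> carrier G1" "b \<in> carrier G2"
      "L' = conj_set ?\<G> (a, b) (quotient_graph G1 G2 z w)"
      unfolding lj by (auto simp: orbit_def)
    let ?z = "morph_conj G1 a z" and ?w = "morph_conj G2 b w"
    have L': "L' = quotient_graph G1 G2 ?z ?w"
      using ab quotient_graph_conj[OF G VG z(2,3)] by simp
    have zw: "?z \<in> morph_class G1 z" "?w \<in> morph_class G2 w"
      using ab by (auto simp: orbit_def)
    have lhs: "class_incidence (le_PK G1 G2) (label i) (label j) =
        int (card {L \<in> ?orb (quotient_graph G1 G2 x y). le_PK G1 G2 (quotient_graph G1 G2 ?z ?w) L})"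
      unfolding class_incidence_def L'_def[symmetric] L' li ..
    show ?thesis
    proof (cases "U = V")
      case True
      note z' = z[folded True]
      show ?thesis
        unfolding lhs card_le_PK_orbit_tensor[OF G UG assms(2,4) x(2,3) z'(2,3) zw]
        using True x z by (simp add: i' j' direct_sum_def)
    next
      case False
      \<comment> \<open>A subgroup above the graph built from \<open>V\<close>-morphisms is itself
        built from \<open>V\<close>-morphisms, so it cannot lie in a class with label in the block
        of \<open>U\<close>.\<close>
      have "\<not> le_PK G1 G2 (quotient_graph G1 G2 ?z ?w) L"
        if L: "L \<in> ?orb (quotient_graph G1 G2 x y)" for L
      proof
        assume le: "le_PK G1 G2 (quotient_graph G1 G2 ?z ?w) L"
        have "subgroup L ?\<G>" using L A.orbit_subset sub[OF UG x(2,3)] by blast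
        then obtain p q where "p \<in> U_morphisms G1 V" "q \<in> U_morphisms G2 V"
          "quotient_graph G1 G2 p q = L"
          using le_PK_quotient_graphE[OF G VG morph_conj_graph(1)[OF G(1) VG z(2) ab(1)]
            morph_conj_graph(1)[OF G(2) VG z(3) ab(2)] _ le] by metis
        then have "U \<cong> V"
          using orbit_quotient_graph_iso[OF G UG VG x(2,3)] L by blast
        with False show False using Us_eq x(1) z(1) by blast
      qed
      then have "card {L \<in> ?orb (quotient_graph G1 G2 x y).
          le_PK G1 G2 (quotient_graph G1 G2 ?z ?w) L} = 0"
        by (simp add: card_eq_0_iff)
      then show ?thesis unfolding lhs using False by (simp add: i' j' direct_sum_def)
    qed
  qed
  show ?thesis
    using bij rep inc by (intro exI[of _ label]) auto
qed

end
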